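(* Over the space $\mathcal{S}$ of star-shaped regions centered at the origin, for no Mulholland function $\psi$ is the topology generated by the Wasserstein metric $W^\psi$ finer than the topology generated by the symmetric-difference metric $V$.
   Context: Fix $n\ge 2$; $\mathbb{E}^n$ is $n$-dimensional Euclidean space with distance $d$ and a chosen origin; $v$ is $n$-dimensional volume. A region is a nonempty bounded open subset of $\mathbb{E}^n$ equal to the interior of its closure. $\mathcal{S}$ is the set of all regions that are star-shaped with respect to the origin. "Finer" is meant in the non-strict sense (finer than or equal to). The symmetric-difference metric is $V(P,Q)=v((P\setminus Q)\cup(Q\setminus P))$. Mulholland function: a continuous, (strictly) increasing $\psi:\mathbb{R}^{\ge0}\to\mathbb{R}^{\ge0}$ with $\psi(0)=0$, $\lim_{x\to\infty}\psi(x)=\infty$, and $\psi^{-1}(\sum_{i=1}^m\psi(x_i+y_i))\le\psi^{-1}(\sum_{i=1}^m\psi(x_i))+\psi^{-1}(\sum_{i=1}^m\psi(y_i))$ for all $m$ and all $x_i,y_i\ge0$. Wasserstein metric: for a region $P$ let $U_P$ be the uniform probability distribution on $P$. For regions $P,Q$, $W^\psi(P,Q)=\inf_\gamma\psi^{-1}\left(\frac{1}{v(P)}\int_P\psi(d(x,\gamma(x)))\,dx\right)$, the infimum over all (measurable) functions $\gamma$ such that if a random variable $X$ has distribution $U_P$ then $\gamma(X)$ has distribution $U_Q$. *)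

theory Defs
  imports "HOL-Analysis.Analysis"
begin

definition region :: "'a::euclidean_space set \<Rightarrow> bool" where
  "region P \<longleftrightarrow> P \<noteq> {} \<and> bounded P \<and> open P \<and> P = interior (closure P)"

definition star_shaped_at :: "'a::euclidean_space \<Rightarrow> 'a set \<Rightarrow> bool" where
  "star_shaped_at c P \<longleftrightarrow> c \<in> P \<and> (\<forall>x\<in>P. closed_segment c x \<subseteq> P)"

definition star_regions :: "'a::euclidean_space set set" where
  "star_regions = {P. region P \<and> star_shaped_at 0 P}"

definition symdiff_dist :: "'a::euclidean_space set \<Rightarrow> 'a set \<Rightarrow> real" where
  "symdiff_dist P Q = measure lborel ((P - Q) \<union> (Q - P))"

text \<open>A function on the nonnegative reals is a function on the reals of which only the
  values on \<open>{0..}\<close> matter; its inverse is \<open>inv_into {0..}\<close>.\<close>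

definition mulholland :: "(real \<Rightarrow> real) \<Rightarrow> bool" where
  "mulholland \<psi> \<longleftrightarrow>
     \<psi> \<in> {0..} \<rightarrow> {0..} \<and>
     continuous_on {0..} \<psi> \<and>
     strict_mono_on {0..} \<psi> \<and>
     \<psi> 0 = 0 \<and>
     filterlim \<psi> at_top at_top \<and>
     (\<forall>(m::nat) (x::nat \<Rightarrow> real) (y::nat \<Rightarrow> real).
        (\<forall>i\<in>{1..m}. 0 \<le> x i \<and> 0 \<le> y i) \<longrightarrow>
        inv_into {0..} \<psi> (\<Sum>i=1..m. \<psi> (x i + y i))
          \<le> inv_into {0..} \<psi> (\<Sum>i=1..m. \<psi> (x i)) + inv_into {0..} \<psi> (\<Sum>i=1..m. \<psi> (y i)))"

text \<open>The law of \<open>\<gamma>(X)\<close> is the image under \<open>\<gamma>\<close> of the law of \<open>X\<close>. The values of \<open>\<gamma>\<close> outside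
  \<open>P\<close>, a null set for the uniform distribution on \<open>P\<close>, are irrelevant.\<close>

definition transport_maps :: "'a::euclidean_space set \<Rightarrow> 'a set \<Rightarrow> ('a \<Rightarrow> 'a) set" where
  "transport_maps P Q =
     {\<gamma>. \<gamma> \<in> borel_measurable borel \<and>
         distr (uniform_measure lborel P) borel \<gamma> = uniform_measure lborel Q}"

definition wasserstein_dist ::
    "(real \<Rightarrow> real) \<Rightarrow> 'a::euclidean_space set \<Rightarrow> 'a set \<Rightarrow> real" where
  "wasserstein_dist \<psi> P Q =
     (INF \<gamma>\<in>transport_maps P Q.
        inv_into {0..} \<psi> (1 / measure lborel P * (LINT x:P|lborel. \<psi> (dist x (\<gamma> x)))))"

text \<open>The library's \<open>Metric_space.mtopology\<close> can be unfolded only under the metric axioms. The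
  following definition makes sense for any distance function; the lemma
  \<open>metric_topology_eq_mtopology\<close> below shows that it is the library's topology when
  the axioms hold.\<close>

definition metric_topology :: "'b set \<Rightarrow> ('b \<Rightarrow> 'b \<Rightarrow> real) \<Rightarrow> 'b topology" where
  "metric_topology S d =
     topology (\<lambda>U. U \<subseteq> S \<and> (\<forall>x\<in>U. \<exists>r>0. {y\<in>S. d x y < r} \<subseteq> U))"

lemma openin_metric_topology:
  "openin (metric_topology S d) U \<longleftrightarrow>
     U \<subseteq> S \<and> (\<forall>x\<in>U. \<exists>r>0. {y\<in>S. d x y < r} \<subseteq> U)"
proof -
  have "istopology (\<lambda>U. U \<subseteq> S \<and> (\<forall>x\<in>U. \<exists>r>0. {y\<in>S. d x y < r} \<subseteq> U))"
    unfolding istopology_def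
  proof (intro conjI allI impI ballI)
    fix A B x
    assume A: "A \<subseteq> S \<and> (\<forall>x\<in>A. \<exists>r>0. {y\<in>S. d x y < r} \<subseteq> A)"
      and B: "B \<subseteq> S \<and> (\<forall>x\<in>B. \<exists>r>0. {y\<in>S. d x y < r} \<subseteq> B)" and x: "x \<in> A \<inter> B"
    obtain r where r: "r > 0" "{y\<in>S. d x y < r} \<subseteq> A"
      using A x by blast
    obtain s where s: "s > 0" "{y\<in>S. d x y < s} \<subseteq> B"
      using B x by blast
    from r s show "\<exists>r>0. {y\<in>S. d x y < r} \<subseteq> A \<inter> B"
      by (intro exI[of _ "min r s"]) auto
  next
    fix K x
    assume K: "\<forall>A\<in>K. A \<subseteq> S \<and> (\<forall>x\<in>A. \<exists>r>0. {y\<in>S. d x y < r} \<subseteq> A)" and "x \<in> \<Union>K"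
    then obtain A where "A \<in> K" "x \<in> A" by blast
    with K obtain r where "r > 0" "{y\<in>S. d x y < r} \<subseteq> A" by blast
    then show "\<exists>r>0. {y\<in>S. d x y < r} \<subseteq> \<Union>K"
      using \<open>A \<in> K\<close> by blast
  qed auto
  then show ?thesis
    by (simp add: metric_topology_def)
qed

lemma topspace_metric_topology: "topspace (metric_topology S d) = S"
proof (rule antisym)
  show "topspace (metric_topology S d) \<subseteq> S"
    using openin_topspace openin_metric_topology by metis
  have "openin (metric_topology S d) S"
    by (auto simp: openin_metric_topology intro: exI[of _ 1])
  then show "S \<subseteq> topspace (metric_topology S d)"
    by (rule openin_subset)
qed

lemma metric_topology_eq_mtopology:
  assumes "Metric_space S d"
  shows "metric_topology S d = Metric_space.mtopology S d"
proof -
  interpret Metric_space S d by fact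
  have ball: "{y\<in>S. d x y < r} = mball x r" if "x \<in> S" for x r
    using that unfolding mball_def by blast
  have "openin (metric_topology S d) U \<longleftrightarrow> openin mtopology U" for U
  proof (cases "U \<subseteq> S")
    case True
    then have "(\<exists>r>0. {y\<in>S. d x y < r} \<subseteq> U) \<longleftrightarrow> (\<exists>r>0. mball x r \<subseteq> U)"
      if "x \<in> U" for x
      by (simp only: ball[OF subsetD[OF True that]])
    then have "(\<forall>x\<in>U. \<exists>r>0. {y\<in>S. d x y < r} \<subseteq> U) \<longleftrightarrow> (\<forall>x\<in>U. \<exists>r>0. mball x r \<subseteq> U)"
      by (rule ball_cong[OF refl])
    then show ?thesis
      by (simp only: openin_metric_topology openin_mtopology Ball_def)
  qed (simp add: openin_metric_topology openin_mtopology)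
  then show ?thesis
    unfolding topology_eq by blast
qed

definition finer_topology :: "'b topology \<Rightarrow> 'b topology \<Rightarrow> bool" where
  "finer_topology X Y \<longleftrightarrow> (\<forall>U. openin Y U \<longrightarrow> openin X U)"

lemma regionD:
  assumes "region P"
  shows "bounded P" "open P" "interior (closure P) = P"
  using assms unfolding region_def by blast+

lemma fmeasurable_region_Diff:
  assumes "region P" "region Q"
  shows "P - Q \<in> fmeasurable lborel"
proof -
  have "P \<in> fmeasurable lborel"
    using regionD[OF assms(1)] emeasure_bounded_finite[of P] by (intro fmeasurableI) auto
  moreover have "Q \<in> sets lborel"
    using regionD[OF assms(2)] by simp
  ultimately show ?thesis by (rule fmeasurable_Diff)
qed

lemma region_subsetI:
  assumes P: "region P" and Q: "region Q" and null: "measure lborel (P - Q) = 0"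
  shows "P \<subseteq> Q"
proof -
  have "P - closure Q = {}"
  proof (rule ccontr)
    assume ne: "P - closure Q \<noteq> {}"
    have op: "open (P - closure Q)" using regionD[OF P] by (simp add: open_Diff)
    have "P - Q \<in> null_sets lborel"
    proof (rule null_setsI)
      show "P - Q \<in> sets lborel"
        using fmeasurable_region_Diff[OF P Q] by (rule fmeasurableD)
      show "emeasure lborel (P - Q) = 0"
        using fmeasurable_region_Diff[OF P Q] null
        by (auto simp: fmeasurable_def measure_def enn2real_eq_0_iff)
    qed
    then have "P - closure Q \<in> null_sets lborel"
    proof (rule null_sets_subset)
      show "P - closure Q \<in> sets lborel" using op by simp
      show "P - closure Q \<subseteq> P - Q" using closure_subset[of Q] by blast
    qed
    then have "P - closure Q \<in> null_sets lebesgue" by (rule null_sets_completionI)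
    then show False
      using op ne open_not_negligible negligible_iff_null_sets by blast
  qed
  then have "P \<subseteq> closure Q" by blast
  then have "P \<subseteq> interior (closure Q)"
    using regionD[OF P] by (simp add: interior_maximal)
  then show ?thesis using regionD[OF Q] by simp
qed

lemma Metric_space_symdiff_dist: "Metric_space star_regions symdiff_dist"
proof
  have fm: "P - Q \<in> fmeasurable lborel" if "P \<in> star_regions" "Q \<in> star_regions" for P Q :: "'a set"
    using that by (simp add: star_regions_def fmeasurable_region_Diff)
  fix P Q R :: "'a set"
  show "0 \<le> symdiff_dist P Q" by (simp add: symdiff_dist_def)
  show "symdiff_dist P Q = symdiff_dist Q P" by (simp add: symdiff_dist_def Un_commute)
  assume PQ: "P \<in> star_regions" "Q \<in> star_regions"
  show "symdiff_dist P Q = 0 \<longleftrightarrow> P = Q"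
  proof
    assume "symdiff_dist P Q = 0"
    moreover have "measure lborel (P - Q) \<le> symdiff_dist P Q"
      "measure lborel (Q - P) \<le> symdiff_dist P Q"
      unfolding symdiff_dist_def using PQ
      by (intro measure_mono_fmeasurable fmeasurable.Un fm fmeasurableD; blast)+
    ultimately have "measure lborel (P - Q) = 0" "measure lborel (Q - P) = 0"
      by (metis measure_nonneg order_antisym)+
    then show "P = Q"
      using PQ by (intro antisym region_subsetI) (auto simp: star_regions_def)
  qed (simp add: symdiff_dist_def)
  assume R: "R \<in> star_regions"
  have "symdiff_dist P R
      \<le> measure lborel (((P - Q) \<union> (Q - P)) \<union> ((Q - R) \<union> (R - Q)))"
    unfolding symdiff_dist_def using PQ R
    by (intro measure_mono_fmeasurable fmeasurable.Un fm sets.Un fmeasurableD; blast)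
  also have "\<dots> \<le> symdiff_dist P Q + symdiff_dist Q R"
    unfolding symdiff_dist_def using PQ R
    by (intro measure_Un_le sets.Un fmeasurableD fm)
  finally show "symdiff_dist P R \<le> symdiff_dist P Q + symdiff_dist Q R" .
qed

end

theory Submission
  imports Defs
begin

text \<open>Let \<open>P\<close> be the open cube with half side one, and let \<open>Q\<close> be a comb inside \<open>P\<close>: in the plane of two
  coordinates, keep only every other one of many equal thin sectors at the origin, together with a
  square of half side \<open>\<epsilon>\<close> around the origin, which makes \<open>Q\<close> a star-shaped region. About half of the
  volume of \<open>P\<close> is missing from \<open>Q\<close>. But \<open>Q\<close> is close to \<open>P\<close> for every Wasserstein metric: cut \<open>P\<close>
  into sectors, most of which are compressed by a linear map onto the neighbouring tooth of \<open>Q\<close>, so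
  that their points hardly move, while very thin sectors left in between are mapped linearly onto the
  gaps between the teeth inside the small square. The volume ratio of thin and thick
  sectors is chosen so that all these linear maps have the same determinant; together they carry
  the uniform distribution on \<open>P\<close> to that on \<open>Q\<close>, and only a mass of order \<open>\<epsilon>\<close> is moved far.\<close>

section \<open>Piecewise linear transport\<close>

text \<open>Fubini with the \<open>b\<close>-coordinate integrated innermost: once the other
  coordinates are fixed, the shear only translates that coordinate, and Lebesgue measure on the line
  is translation invariant.\<close>

lemma emeasure_lborel_shear_vimage:
  fixes a b :: "'a::euclidean_space"
  assumes a: "a \<in> Basis" and b: "b \<in> Basis" and ab: "a \<noteq> b" and E[measurable]: "E \<in> sets borel"
  shows "emeasure lborel ((\<lambda>p. p + (c * (p \<bullet> a)) *\<^sub>R b) -` E) = emeasure lborel E"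
proof -
  interpret product_sigma_finite "\<lambda>_::'a. lborel :: real measure" by standard
  define B where "B = Basis - {b}"
  have B: "Basis = insert b B" "b \<notin> B" "finite B" "a \<in> B"
    using a b ab by (auto simp: B_def)
  define V where "V g = (\<Sum>k\<in>Basis. g k *\<^sub>R k)" for g :: "'a \<Rightarrow> real"
  have V_meas[measurable]: "V \<in> borel_measurable (Pi\<^sub>M Basis (\<lambda>_. lborel))"
    unfolding V_def[abs_def] by measurable
  have V_upd: "V (g(b := y)) = y *\<^sub>R b + (\<Sum>k\<in>B. g k *\<^sub>R k)" for g y
  proof -
    have "V (g(b := y)) = y *\<^sub>R b + (\<Sum>k\<in>B. (g(b := y)) k *\<^sub>R k)"
      unfolding V_def B(1) by (subst sum.insert) (use B in auto)
    also have "(\<Sum>k\<in>B. (g(b := y)) k *\<^sub>R k) = (\<Sum>k\<in>B. g k *\<^sub>R k)"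
      by (rule sum.cong) (use B in auto)
    finally show ?thesis .
  qed
  have V_a: "V (g(b := y)) \<bullet> a = g a" for g y
    unfolding V_def using a ab by (simp add: inner_sum_left_Basis)
  have nn: "(\<integral>\<^sup>+p. h p \<partial>lborel) =
      (\<integral>\<^sup>+g. (\<integral>\<^sup>+y. h (V (g(b := y))) \<partial>lborel) \<partial>Pi\<^sub>M B (\<lambda>_. lborel))"
    if [measurable]: "h \<in> borel_measurable borel" for h :: "'a \<Rightarrow> ennreal"
  proof -
    have "(\<integral>\<^sup>+p. h p \<partial>lborel) = (\<integral>\<^sup>+g. h (V g) \<partial>Pi\<^sub>M Basis (\<lambda>_. lborel))"
      by (subst lborel_eq) (simp add: nn_integral_distr V_def)
    also have "\<dots> = (\<integral>\<^sup>+g. (\<integral>\<^sup>+y. h (V (g(b := y))) \<partial>lborel) \<partial>Pi\<^sub>M B (\<lambda>_. lborel))"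
      unfolding B(1)
      by (rule product_nn_integral_insert[OF B(3,2)]) (use V_meas in \<open>simp add: B(1)[symmetric]\<close>)
    finally show ?thesis .
  qed
  let ?S = "\<lambda>p. p + (c * (p \<bullet> a)) *\<^sub>R b"
  have "emeasure lborel (?S -` E) = (\<integral>\<^sup>+p. indicator E (?S p) \<partial>lborel)"
    by (subst nn_integral_indicator[symmetric]) (auto intro!: nn_integral_cong measurable_sets_borel[OF _ E] split: split_indicator)
  also have "\<dots> = (\<integral>\<^sup>+g. (\<integral>\<^sup>+y. indicator E (V (g(b := c * g a + 1 * y))) \<partial>lborel) \<partial>Pi\<^sub>M B (\<lambda>_. lborel))"
    by (subst nn, measurable, unfold V_a, unfold V_upd)
      (simp add: algebra_simps)
  also have "\<dots> = (\<integral>\<^sup>+g. (\<integral>\<^sup>+y. indicator E (V (g(b := y))) \<partial>lborel) \<partial>Pi\<^sub>M B (\<lambda>_. lborel))"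
  proof (rule nn_integral_cong)
    fix g
    have "(\<lambda>y. indicator E (V (g(b := y))) :: ennreal) \<in> borel_measurable borel"
      unfolding V_upd by measurable
    from nn_integral_real_affine[OF this, of 1 "c * g a"]
    show "(\<integral>\<^sup>+y. indicator E (V (g(b := c * g a + 1 * y))) \<partial>lborel)
        = (\<integral>\<^sup>+y. indicator E (V (g(b := y))) \<partial>lborel)"
      by simp
  qed
  also have "\<dots> = (\<integral>\<^sup>+p. indicator E p \<partial>lborel)"
    by (rule nn[symmetric]) measurable
  also have "\<dots> = emeasure lborel E" by simp
  finally show ?thesis .
qed

text \<open>On the plane of \<open>a\<close> and \<open>b\<close> this is the lower triangular
  matrix with rows \<open>(\<rho>, 0)\<close> and \<open>(\<alpha>, \<beta>)\<close>. Writing it as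
  \<open>p\<close> plus a correction makes it the identity on all other coordinates.\<close>

definition plane_map :: "'a::euclidean_space \<Rightarrow> 'a \<Rightarrow> real \<Rightarrow> real \<Rightarrow> real \<Rightarrow> 'a \<Rightarrow> 'a" where
  "plane_map a b \<rho> \<alpha> \<beta> p =
     p + ((\<rho> - 1) * (p \<bullet> a)) *\<^sub>R a + (\<alpha> * (p \<bullet> a) + (\<beta> - 1) * (p \<bullet> b)) *\<^sub>R b"

lemma plane_map_inner:
  assumes "a \<in> Basis" "b \<in> Basis" "a \<noteq> b" 
  shows "plane_map a b \<rho> \<alpha> \<beta> p \<bullet> a = \<rho> * (p \<bullet> a)"
    and "plane_map a b \<rho> \<alpha> \<beta> p \<bullet> b = \<alpha> * (p \<bullet> a) + \<beta> * (p \<bullet> b)"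
    and "k \<in> Basis \<Longrightarrow> k \<noteq> a \<Longrightarrow> k \<noteq> b \<Longrightarrow> plane_map a b \<rho> \<alpha> \<beta> p \<bullet> k = p \<bullet> k"
  using assms unfolding plane_map_def by (auto simp: inner_simps inner_Basis algebra_simps)

lemma plane_map_measurable[measurable]: "plane_map a b \<rho> \<alpha> \<beta> \<in> borel_measurable borel"
  unfolding plane_map_def[abs_def] by measurable

text \<open>The map factors as a diagonal scaling \<open>T\<close> of determinant
  \<open>\<rho> * \<beta>\<close> followed by a shear \<open>S\<close>, which preserves
  volume.\<close>

lemma emeasure_plane_map_vimage:
  fixes a b :: "'a::euclidean_space"
  assumes a: "a \<in> Basis" and b: "b \<in> Basis" and ab: "a \<noteq> b" and E: "E \<in> sets borel"
    and pos: "0 < \<rho>" "0 < \<beta>"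
  shows "emeasure lborel (plane_map a b \<rho> \<alpha> \<beta> -` E) = ennreal (1 / (\<rho> * \<beta>)) * emeasure lborel E"
proof -
  define c where "c k = (if k = a then \<rho> else if k = b then \<beta> else 1)" for k :: 'a
  \<comment> \<open>The summand 0 gives \<open>T\<close> the affine shape expected by
    \<open>lborel_affine_euclidean\<close>.\<close>
  define T where "T x = 0 + (\<Sum>k\<in>Basis. (c k * (x \<bullet> k)) *\<^sub>R k)" for x :: 'a
  define S where "S p = p + (\<alpha> / \<rho> * (p \<bullet> a)) *\<^sub>R b" for p :: 'a
  have T_meas[measurable]: "T \<in> borel_measurable borel" and S_meas[measurable]: "S \<in> borel_measurable borel"
    unfolding T_def[abs_def] S_def[abs_def] by measurable
  have T_inner: "T x \<bullet> k = c k * (x \<bullet> k)" if "k \<in> Basis" for x k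
    unfolding T_def using that by (simp add: inner_sum_left_Basis)
  have comp: "plane_map a b \<rho> \<alpha> \<beta> p = S (T p)" for p
  proof (rule euclidean_eqI)
    fix k :: 'a assume k: "k \<in> Basis"
    show "plane_map a b \<rho> \<alpha> \<beta> p \<bullet> k = S (T p) \<bullet> k"
      using plane_map_inner[OF a b ab] a b ab k pos
      by (cases "k = a"; cases "k = b")
        (auto simp: S_def inner_simps T_inner c_def inner_Basis)
  qed
  have prod: "(\<Prod>k\<in>Basis. \<bar>c k\<bar>) = \<rho> * \<beta>"
  proof -
    have eq: "(Basis :: 'a set) = insert a (insert b (Basis - {a,b}))" using a b by auto
    have "(\<Prod>k\<in>Basis - {a,b}. \<bar>c k\<bar>) = 1" by (rule prod.neutral) (auto simp: c_def)
    then show ?thesis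
      by (subst eq) (use ab pos in \<open>auto simp: c_def\<close>)
  qed
  have F: "S -` E \<in> sets borel" using measurable_sets_borel[OF S_meas E] .
  have "emeasure lborel E = emeasure lborel (S -` E)"
    unfolding S_def by (rule emeasure_lborel_shear_vimage[OF a b ab E, symmetric])
  also have "\<dots> = emeasure (density (distr lborel borel T) (\<lambda>_. (\<Prod>k\<in>Basis. \<bar>c k\<bar>))) (S -` E)"
    unfolding T_def[abs_def] using pos by (subst lborel_affine_euclidean[of c 0]) (auto simp: c_def)
  also have "\<dots> = ennreal (\<rho> * \<beta>) * emeasure lborel (T -` S -` E)"
    using F by (simp add: prod emeasure_density_const emeasure_distr)
  also have "T -` S -` E = plane_map a b \<rho> \<alpha> \<beta> -` E"
    by (auto simp: comp)
  finally have "emeasure lborel E = ennreal (\<rho> * \<beta>) * emeasure lborel (plane_map a b \<rho> \<alpha> \<beta> -` E)" .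
  then show ?thesis
    using pos by (simp add: mult.assoc[symmetric] ennreal_mult'[symmetric])
qed

text \<open>Since all pieces scale volume by the same factor, no density has to be computed: the
  uniform distribution on \<open>P\<close> is carried to the uniform distribution on \<open>Q\<close>.\<close>

lemma piecewise_transport:
  fixes P Q :: "'a::euclidean_space set" and A B :: "'i \<Rightarrow> 'a set" and L :: "'i \<Rightarrow> 'a \<Rightarrow> 'a"
  assumes I: "finite I" and c: "0 < c"
    and P: "P \<in> sets borel" "emeasure lborel P \<noteq> 0" "emeasure lborel P \<noteq> \<infinity>" and Q: "Q \<in> sets borel"
    and A: "\<And>i. i \<in> I \<Longrightarrow> A i \<in> sets borel" "disjoint_family_on A I" "(\<Union>i\<in>I. A i) \<subseteq> P"
      "emeasure lborel (P - (\<Union>i\<in>I. A i)) = 0"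
    and B: "\<And>i. i \<in> I \<Longrightarrow> B i \<in> sets borel" "disjoint_family_on B I" "(\<Union>i\<in>I. B i) \<subseteq> Q"
      "emeasure lborel (Q - (\<Union>i\<in>I. B i)) = 0"
    and L: "\<And>i. i \<in> I \<Longrightarrow> L i \<in> borel_measurable borel"
      "\<And>i p. i \<in> I \<Longrightarrow> p \<in> A i \<longleftrightarrow> L i p \<in> B i"
      "\<And>i E. i \<in> I \<Longrightarrow> E \<in> sets borel \<Longrightarrow>
         emeasure lborel (L i -` E) = ennreal c * emeasure lborel E"
  defines "\<gamma> \<equiv> (\<lambda>p. \<Sum>i\<in>I. indicator (A i) p *\<^sub>R L i p)"
  shows "\<gamma> \<in> transport_maps P Q"
    and "emeasure lborel P = ennreal c * emeasure lborel Q"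
    and "\<And>i p. i \<in> I \<Longrightarrow> p \<in> A i \<Longrightarrow> \<gamma> p = L i p"
proof -
  show \<gamma>_eq: "\<gamma> p = L i p" if "i \<in> I" "p \<in> A i" for i p
  proof -
    have "indicator (A k) p *\<^sub>R L k p = (if k = i then L i p else 0)" if "k \<in> I" for k
      using A(2) \<open>k \<in> I\<close> \<open>i \<in> I\<close> \<open>p \<in> A i\<close> unfolding disjoint_family_on_def
      by (auto simp: indicator_def)
    then have "\<gamma> p = (\<Sum>k\<in>I. if k = i then L i p else 0)"
      unfolding \<gamma>_def by (rule sum.cong[OF refl])
    then show ?thesis using I \<open>i \<in> I\<close> by simp
  qed
  have \<gamma>_meas: "\<gamma> \<in> borel_measurable borel"
    unfolding \<gamma>_def using A(1) L(1) by (intro borel_measurable_sum borel_measurable_scaleR borel_measurable_indicator) auto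
  have split: "emeasure lborel (R \<inter> E) = (\<Sum>i\<in>I. emeasure lborel (C i \<inter> E))"
    if R: "R \<in> sets borel" and C: "\<And>i. i \<in> I \<Longrightarrow> C i \<in> sets borel" "disjoint_family_on C I" "(\<Union>i\<in>I. C i) \<subseteq> R"
      "emeasure lborel (R - (\<Union>i\<in>I. C i)) = 0" and E: "E \<in> sets borel"
    for R E and C :: "'i \<Rightarrow> 'a set"
  proof -
    have U: "(\<Union>i\<in>I. C i) \<in> sets borel" using I C(1) by auto
    have "emeasure lborel (R \<inter> E) = emeasure lborel ((\<Union>i\<in>I. C i) \<inter> E)"
    proof (rule emeasure_eq_AE)
      have "R - (\<Union>i\<in>I. C i) \<in> null_sets lborel" using C(4) R U by auto
      then have "AE x in lborel. x \<notin> R - (\<Union>i\<in>I. C i)" by (rule AE_not_in)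
      then show "AE x in lborel. x \<in> R \<inter> E \<longleftrightarrow> x \<in> (\<Union>i\<in>I. C i) \<inter> E"
        by eventually_elim (use C(3) in auto)
    qed (use R E U in auto)
    also have "(\<Union>i\<in>I. C i) \<inter> E = (\<Union>i\<in>I. C i \<inter> E)" by auto
    also have "emeasure lborel \<dots> = (\<Sum>i\<in>I. emeasure lborel (C i \<inter> E))"
      by (rule sum_emeasure[symmetric]) (use C E I in \<open>auto simp: disjoint_family_on_def\<close>)
    finally show ?thesis .
  qed
  \<comment> \<open>The transport identity before normalisation. Taking \<open>E = UNIV\<close>
    gives the volume ratio, and the factor \<open>c\<close> then cancels in the quotients.\<close>
  have main: "emeasure lborel (P \<inter> \<gamma> -` E) = ennreal c * emeasure lborel (Q \<inter> E)" if E: "E \<in> sets borel" for E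
  proof -
    have "emeasure lborel (P \<inter> \<gamma> -` E) = (\<Sum>i\<in>I. emeasure lborel (A i \<inter> \<gamma> -` E))"
      by (rule split[OF P(1) A measurable_sets_borel[OF \<gamma>_meas E]])
    also have "\<dots> = (\<Sum>i\<in>I. ennreal c * emeasure lborel (B i \<inter> E))"
    proof (rule sum.cong[OF refl])
      fix i assume i: "i \<in> I"
      \<comment> \<open>Both directions of \<open>L(2)\<close> enter: \<open>A i\<close> is the
        whole preimage of \<open>B i\<close> under \<open>L i\<close>.\<close>
      have "A i \<inter> \<gamma> -` E = L i -` (B i \<inter> E)"
        using \<gamma>_eq[OF i] L(2)[OF i] by auto
      then show "emeasure lborel (A i \<inter> \<gamma> -` E) = ennreal c * emeasure lborel (B i \<inter> E)"
        using L(3)[OF i, of "B i \<inter> E"] B(1)[OF i] E by simp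
    qed
    also have "\<dots> = ennreal c * emeasure lborel (Q \<inter> E)"
      by (simp add: split[OF Q B E] sum_distrib_left)
    finally show ?thesis .
  qed
  show PQ: "emeasure lborel P = ennreal c * emeasure lborel Q"
    using main[of UNIV] by simp
  have Qpos: "emeasure lborel Q \<noteq> 0" "emeasure lborel Q \<noteq> \<infinity>"
    using P(2,3) PQ c by (auto simp: ennreal_mult_eq_top_iff)
  show "\<gamma> \<in> transport_maps P Q"
    unfolding transport_maps_def
  proof (intro CollectI conjI measure_eqI \<gamma>_meas)
    fix E assume "E \<in> sets (distr (uniform_measure lborel P) borel \<gamma>)"
    then have E: "E \<in> sets borel" by simp
    have "emeasure (distr (uniform_measure lborel P) borel \<gamma>) E = emeasure lborel (P \<inter> \<gamma> -` E) / emeasure lborel P"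
      using \<gamma>_meas E P(1) measurable_sets_borel[OF \<gamma>_meas E]
      by (subst emeasure_distr) (auto simp: measurable_def)
    also have "\<dots> = emeasure lborel (Q \<inter> E) / emeasure lborel Q"
      unfolding main[OF E] PQ using c
      by (subst (1 2) mult.commute) (simp add: divide_mult_eq)
    also have "\<dots> = emeasure (uniform_measure lborel Q) E"
      using Q E by simp
    finally show "emeasure (distr (uniform_measure lborel P) borel \<gamma>) E = emeasure (uniform_measure lborel Q) E" .
  qed simp
qed

section \<open>Sectors and combs\<close>

text \<open>Divided by \<open>m * \<bar>p \<bullet> a\<bar>\<close>, the last condition says that
  the slope of \<open>p\<close> differs from \<open>j / m\<close> by less than \<open>w / m\<close>.
  A sector thus consists of opposite wedges about the line of slope \<open>j / m\<close>; for
  \<open>j\<close> equal to \<open>m\<close> or \<open>- m\<close>, where that line is a diagonal,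
  only one side of it is left.\<close>

definition sector ::
    "'a::euclidean_space \<Rightarrow> 'a \<Rightarrow> nat \<Rightarrow> real \<Rightarrow> real \<Rightarrow> int \<Rightarrow> 'a set" where
  "sector a b m w r j = {p \<in> box (- One) One.
     \<bar>p \<bullet> a\<bar> < r \<and> \<bar>p \<bullet> b\<bar> < \<bar>p \<bullet> a\<bar> \<and> \<bar>m * (p \<bullet> b) - j * (p \<bullet> a)\<bar> < w * \<bar>p \<bullet> a\<bar>}"

text \<open>The quotient \<open>min / max\<close> is the slope of \<open>p\<close>, folded into the unit interval by the symmetries
  of the square; at points with \<open>p \<bullet> a = p \<bullet> b = 0\<close> it is \<open>0 / 0 = 0\<close>, and the cosine is positive.\<close>

definition comb :: "'a::euclidean_space \<Rightarrow> 'a \<Rightarrow> nat \<Rightarrow> real \<Rightarrow> 'a set" where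
  "comb a b m \<epsilon> = {p \<in> box (- One) One. max \<bar>p \<bullet> a\<bar> \<bar>p \<bullet> b\<bar> < \<epsilon> \<or>
     cos (pi * (m * (min \<bar>p \<bullet> a\<bar> \<bar>p \<bullet> b\<bar> / max \<bar>p \<bullet> a\<bar> \<bar>p \<bullet> b\<bar>))) < 0}"

text \<open>Sectors with odd index are compressed into the teeth of the comb; sectors with even index,
  which are thin, are spread over the gaps between the teeth near the origin. The widths are chosen
  so that every \<open>sector_map\<close> has the same determinant \<open>(1 + \<epsilon>\<^sup>2) / 2\<close>.\<close>

definition reach :: "real \<Rightarrow> int \<Rightarrow> real" where
  "reach \<epsilon> j = (if odd j then 1 else \<epsilon>)"

definition width :: "real \<Rightarrow> int \<Rightarrow> real" where
  "width \<epsilon> j = (reach \<epsilon> j)\<^sup>2 / (1 + \<epsilon>\<^sup>2)"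

text \<open>The off-diagonal entry is chosen so that the line of slope \<open>j / m\<close> is
  invariant: points on it are multiplied by \<open>\<rho>\<close>, while deviations from it in
  direction \<open>b\<close> are multiplied by \<open>\<beta>\<close>.\<close>

definition sector_map ::
    "'a::euclidean_space \<Rightarrow> 'a \<Rightarrow> nat \<Rightarrow> real \<Rightarrow> int \<Rightarrow> 'a \<Rightarrow> 'a" where
  "sector_map a b m \<epsilon> j =
     (let \<rho> = reach \<epsilon> j; \<beta> = (1 + \<epsilon>\<^sup>2) / (2 * \<rho>) in plane_map a b \<rho> ((\<rho> - \<beta>) * (j / m)) \<beta>)"

lemma mem_box_One: "p \<in> box (- One) One \<longleftrightarrow> (\<forall>k\<in>Basis. \<bar>p \<bullet> k\<bar> < 1)"
  by (auto simp: mem_box abs_less_iff)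

lemma comb_commute: "comb a b m \<epsilon> = comb b a m \<epsilon>"
  unfolding comb_def by (simp add: max.commute min.commute)

section \<open>Widths of neighbouring sectors\<close>

lemma reach_pos: "0 < \<epsilon> \<Longrightarrow> 0 < reach \<epsilon> j"
  by (simp add: reach_def)

lemma reach_le_1: "\<epsilon> \<le> 1 \<Longrightarrow> reach \<epsilon> j \<le> 1"
  by (simp add: reach_def)

lemma one_plus_square_pos: "0 < 1 + (\<epsilon>::real)\<^sup>2"
  by (simp add: add_pos_nonneg)

lemma width_pos: "0 < \<epsilon> \<Longrightarrow> 0 < width \<epsilon> j"
  unfolding width_def by (intro divide_pos_pos zero_less_power reach_pos one_plus_square_pos)

text \<open>One of two consecutive indices is odd, so the numerators are 1 and the square of
  \<open>\<epsilon>\<close>. Hence the slope intervals of neighbouring sectors abut without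
  overlap.\<close>

lemma width_Suc: "width \<epsilon> j + width \<epsilon> (j + 1) = 1"
  using one_plus_square_pos[of \<epsilon>]
  by (auto simp: width_def reach_def divide_simps)

lemma width_less_1: "0 < \<epsilon> \<Longrightarrow> width \<epsilon> j < 1"
  using width_Suc[of \<epsilon> j] width_pos[of \<epsilon> "j + 1"] by simp

lemma width_separated:
  assumes "0 < \<epsilon>" "j \<noteq> k"
  shows "width \<epsilon> j + width \<epsilon> k \<le> \<bar>real_of_int j - real_of_int k\<bar>"
proof -
  consider "k = j + 1" | "j = k + 1" | "\<bar>j - k\<bar> \<ge> 2" using assms(2) by linarith
  then show ?thesis
  proof cases
    case 1 then show ?thesis using width_Suc[of \<epsilon> j] by simp
  next
    case 2 then show ?thesis using width_Suc[of \<epsilon> k] by simp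
  next
    case 3
    then have "2 \<le> \<bar>real_of_int j - real_of_int k\<bar>" by linarith
    then show ?thesis using width_less_1[OF assms(1), of j] width_less_1[OF assms(1), of k] by linarith
  qed
qed

section \<open>The linear map on a single sector\<close>

text \<open>For an inner index the condition holds automatically; for \<open>j\<close> equal to
  \<open>m\<close> or \<open>- m\<close> it depends only on the sign of \<open>u * x\<close>. A
  sector map preserves this sign, so it respects the cut along the diagonals.\<close>

lemma abs_less_iff_slope:
  fixes x y u :: real and j :: int and m :: nat
  assumes m: "0 < m" and j: "\<bar>j\<bar> \<le> int m" and u: "\<bar>u\<bar> < \<bar>x\<bar>" and y: "m * y = j * x + u"
  shows "\<bar>y\<bar> < \<bar>x\<bar> \<longleftrightarrow> \<bar>j\<bar> < int m \<or> (j = int m \<and> u * x < 0) \<or> (j = - int m \<and> 0 < u * x)"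
proof -
  have x: "x \<noteq> 0" using u by auto
  have eq: "\<bar>y\<bar> < \<bar>x\<bar> \<longleftrightarrow> \<bar>j * x + u\<bar> < m * \<bar>x\<bar>"
    using m by (simp add: y[symmetric] abs_mult)
  define z where "z = m * \<bar>x\<bar>"
  have "1 * \<bar>x\<bar> \<le> m * \<bar>x\<bar>" using m by (intro mult_right_mono) auto
  then have "\<bar>u\<bar> < z" using u by (simp add: z_def)
  then have sgn: "\<bar>z + u\<bar> < z \<longleftrightarrow> u < 0" "\<bar>- z + u\<bar> < z \<longleftrightarrow> 0 < u"
    by linarith+
  have z: "m * \<bar>x\<bar> = z" "0 < x \<Longrightarrow> m * x = z" "\<not> 0 < x \<Longrightarrow> m * x = - z"
    by (auto simp: z_def)
  consider "\<bar>j\<bar> < int m" | "j = int m" | "j = - int m" using j by linarith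
  then show ?thesis
  proof cases
    case 1
    then have "real_of_int \<bar>j\<bar> \<le> real m - 1" by linarith
    then have "real_of_int \<bar>j\<bar> * \<bar>x\<bar> \<le> (real m - 1) * \<bar>x\<bar>" by (rule mult_right_mono) simp
    moreover have "\<bar>j * x + u\<bar> \<le> real_of_int \<bar>j\<bar> * \<bar>x\<bar> + \<bar>u\<bar>"
      using abs_triangle_ineq[of "j * x" u] by (simp add: abs_mult)
    ultimately have "\<bar>j * x + u\<bar> < m * \<bar>x\<bar>"
      using u by (simp add: algebra_simps)
    then show ?thesis using 1 eq by simp
  next
    case 2
    then show ?thesis using eq z sgn m by (cases "0 < x") (auto simp: mult_less_0_iff)
  next
    case 3
    then show ?thesis using eq z sgn m x by (cases "0 < x") (auto simp: zero_less_mult_iff)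
  qed
qed

text \<open>In the coordinates \<open>x = p \<bullet> a\<close> and
  \<open>u = m * (p \<bullet> b) - j * x\<close> the map is diagonal: \<open>x\<close> is multiplied
  by \<open>\<rho>\<close> and \<open>u\<close> by \<open>\<beta>\<close>. Since
  \<open>width \<epsilon> j\<close> equals \<open>\<rho> / (2 * \<beta>)\<close>, the bound on
  \<open>u / x\<close> becomes 1/2.\<close>

lemma sector_map_mem_iff:
  fixes a b :: "'a::euclidean_space"
  assumes ab: "a \<in> Basis" "b \<in> Basis" "a \<noteq> b" and m: "0 < m" and \<epsilon>: "0 < \<epsilon>" "\<epsilon> \<le> 1"
    and j: "\<bar>j\<bar> \<le> int m"
  shows "p \<in> sector a b m (width \<epsilon> j) 1 j \<longleftrightarrow>
    sector_map a b m \<epsilon> j p \<in> sector a b m (1 / 2) (reach \<epsilon> j) j"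
proof -
  define \<rho> where "\<rho> = reach \<epsilon> j"
  define \<beta> where "\<beta> = (1 + \<epsilon>\<^sup>2) / (2 * \<rho>)"
  define q where "q = sector_map a b m \<epsilon> j p"
  define u where "u = m * (p \<bullet> b) - j * (p \<bullet> a)"
  have \<rho>: "0 < \<rho>" "\<rho> \<le> 1" using reach_pos reach_le_1 \<epsilon> by (auto simp: \<rho>_def)
  have \<beta>: "0 < \<beta>" using \<rho> one_plus_square_pos[of \<epsilon>] by (simp add: \<beta>_def)
  have q_eq: "q = plane_map a b \<rho> ((\<rho> - \<beta>) * (j / m)) \<beta> p"
    unfolding q_def sector_map_def \<rho>_def \<beta>_def by (simp add: Let_def)
  have qa: "q \<bullet> a = \<rho> * (p \<bullet> a)" and qb: "q \<bullet> b = (\<rho> - \<beta>) * (j / m) * (p \<bullet> a) + \<beta> * (p \<bullet> b)"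
    and qk: "\<And>k. k \<in> Basis \<Longrightarrow> k \<noteq> a \<Longrightarrow> k \<noteq> b \<Longrightarrow> q \<bullet> k = p \<bullet> k"
    unfolding q_eq using plane_map_inner[OF ab] by auto
  have "m * (q \<bullet> b) = (\<rho> - \<beta>) * j * (p \<bullet> a) + \<beta> * (m * (p \<bullet> b))"
    using m by (simp add: qb field_simps)
  then have qb': "m * (q \<bullet> b) = j * (q \<bullet> a) + \<beta> * u"
    by (simp add: qa u_def algebra_simps)
  have pb': "m * (p \<bullet> b) = j * (p \<bullet> a) + u" by (simp add: u_def)
  have w: "width \<epsilon> j = \<rho> / (2 * \<beta>)"
    using \<rho> one_plus_square_pos[of \<epsilon>]
    by (simp add: width_def \<beta>_def \<rho>_def[symmetric] power2_eq_square field_simps)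
  have slope: "\<bar>u\<bar> < width \<epsilon> j * \<bar>p \<bullet> a\<bar> \<longleftrightarrow> \<bar>\<beta> * u\<bar> < 1 / 2 * \<bar>q \<bullet> a\<bar>"
    using \<beta> \<rho> by (simp add: w qa abs_mult field_simps)
  have diag: "\<bar>p \<bullet> b\<bar> < \<bar>p \<bullet> a\<bar> \<longleftrightarrow> \<bar>q \<bullet> b\<bar> < \<bar>q \<bullet> a\<bar>" if s: "\<bar>u\<bar> < width \<epsilon> j * \<bar>p \<bullet> a\<bar>"
  proof -
    have "width \<epsilon> j * \<bar>p \<bullet> a\<bar> \<le> 1 * \<bar>p \<bullet> a\<bar>"
      using width_less_1[OF \<epsilon>(1), of j] by (intro mult_right_mono) auto
    then have 1: "\<bar>u\<bar> < \<bar>p \<bullet> a\<bar>" using s by linarith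
    have 2: "\<bar>\<beta> * u\<bar> < \<bar>q \<bullet> a\<bar>" using s slope by linarith
    have "\<beta> * u * (q \<bullet> a) = (\<beta> * \<rho>) * (u * (p \<bullet> a))" by (simp add: qa)
    moreover have "0 < \<beta> * \<rho>" using \<beta> \<rho> by simp
    ultimately have "\<beta> * u * (q \<bullet> a) < 0 \<longleftrightarrow> u * (p \<bullet> a) < 0" "0 < \<beta> * u * (q \<bullet> a) \<longleftrightarrow> 0 < u * (p \<bullet> a)"
      by (simp_all only: mult_less_0_iff[of "\<beta> * \<rho>"] zero_less_mult_iff[of "\<beta> * \<rho>"]) (use less_asym in blast)+
    then show ?thesis
      using abs_less_iff_slope[OF m j 1 pb'] abs_less_iff_slope[OF m j 2 qb'] by simp
  qed
  have a1: "\<bar>p \<bullet> a\<bar> < 1 \<longleftrightarrow> \<bar>q \<bullet> a\<bar> < \<rho>" using \<rho> by (simp add: qa abs_mult)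
  have box: "p \<in> box (- One) One \<longleftrightarrow> q \<in> box (- One) One"
    if "\<bar>p \<bullet> a\<bar> < 1" "\<bar>q \<bullet> a\<bar> < \<rho>" "\<bar>p \<bullet> b\<bar> < \<bar>p \<bullet> a\<bar>" "\<bar>q \<bullet> b\<bar> < \<bar>q \<bullet> a\<bar>"
  proof -
    have "\<bar>p \<bullet> k\<bar> < 1 \<longleftrightarrow> \<bar>q \<bullet> k\<bar> < 1" if "k \<in> Basis" for k
      using qk[OF that] \<open>\<bar>p \<bullet> a\<bar> < 1\<close> \<open>\<bar>q \<bullet> a\<bar> < \<rho>\<close> \<open>\<bar>p \<bullet> b\<bar> < \<bar>p \<bullet> a\<bar>\<close> \<open>\<bar>q \<bullet> b\<bar> < \<bar>q \<bullet> a\<bar>\<close> \<rho>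
      by (cases "k = a"; cases "k = b") auto
    then show ?thesis unfolding mem_box_One by blast
  qed
  have "p \<in> sector a b m (width \<epsilon> j) 1 j \<longleftrightarrow> q \<in> sector a b m (1 / 2) \<rho> j"
    unfolding sector_def mem_Collect_eq u_def[symmetric] qb' add_diff_cancel_left'
    using slope diag a1 box by blast
  then show ?thesis by (simp add: q_def \<rho>_def)
qed

lemma sector_map_measurable[measurable]: "sector_map a b m \<epsilon> j \<in> borel_measurable borel"
  unfolding sector_map_def Let_def by measurable

text \<open>The reach cancels in the determinant, so the factor is the same for all
  \<open>j\<close>, as \<open>piecewise_transport\<close> demands.\<close>

lemma emeasure_sector_map_vimage:
  assumes "a \<in> Basis" "b \<in> Basis" "a \<noteq> b" "E \<in> sets borel" "0 < \<epsilon>"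
  shows "emeasure lborel (sector_map a b m \<epsilon> j -` E) =
    ennreal (2 / (1 + \<epsilon>\<^sup>2)) * emeasure lborel E"
proof -
  have "0 < reach \<epsilon> j" using assms by (intro reach_pos)
  then show ?thesis
    unfolding sector_map_def Let_def using assms one_plus_square_pos[of \<epsilon>]
    by (subst emeasure_plane_map_vimage) auto
qed

text \<open>For odd \<open>j\<close> the reach is 1, so the point moves only in direction
  \<open>b\<close>, by at most its deviation from the line of slope \<open>j / m\<close>. Inside the
  sector this deviation is at most \<open>1 / m\<close>.\<close>

lemma dist_sector_map_odd:
  fixes a b :: "'a::euclidean_space"
  assumes p: "p \<in> sector a b m w 1 j" and w: "w \<le> 1" and "odd j" "0 < m" "b \<in> Basis" "0 < \<epsilon>" "\<epsilon> \<le> 1"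
  shows "dist p (sector_map a b m \<epsilon> j p) \<le> 1 / m"
proof -
  define c where "c = j / m"
  define s where "s = ((\<epsilon>\<^sup>2 - 1) / 2) * (p \<bullet> b - c * (p \<bullet> a))"
  have "sector_map a b m \<epsilon> j p = p + s *\<^sub>R b"
    using \<open>odd j\<close> unfolding sector_map_def Let_def plane_map_def s_def c_def[symmetric]
    by (simp add: reach_def field_simps)
  then have d: "dist p (sector_map a b m \<epsilon> j p) = \<bar>s\<bar>"
    using \<open>b \<in> Basis\<close> by (simp add: dist_norm)
  have e: "\<bar>(\<epsilon>\<^sup>2 - 1) / 2\<bar> \<le> 1"
    using \<open>0 < \<epsilon>\<close> \<open>\<epsilon> \<le> 1\<close> power_le_one[of \<epsilon> 2] by (simp add: abs_if)
  have "w * \<bar>p \<bullet> a\<bar> \<le> 1 * \<bar>p \<bullet> a\<bar>" using w by (intro mult_right_mono) auto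
  then have "\<bar>m * (p \<bullet> b) - j * (p \<bullet> a)\<bar> \<le> 1" using p by (auto simp: sector_def)
  moreover have "m * (p \<bullet> b) - j * (p \<bullet> a) = m * (p \<bullet> b - c * (p \<bullet> a))"
    using \<open>0 < m\<close> by (simp add: c_def field_simps)
  ultimately have "\<bar>p \<bullet> b - c * (p \<bullet> a)\<bar> \<le> 1 / m"
    using \<open>0 < m\<close> by (simp add: abs_mult pos_le_divide_eq mult.commute)
  then have "\<bar>s\<bar> \<le> 1 * (1 / m)"
    unfolding s_def abs_mult using e by (intro mult_mono) auto
  then show ?thesis using d by simp
qed

section \<open>Tilings of the cube and of the comb by sectors\<close>

lemma sectors_disjoint:
  assumes "w + w' \<le> \<bar>real_of_int j - real_of_int k\<bar>"
  shows "sector a b m w r j \<inter> sector a b m w' r' k = {}"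
proof (rule ccontr)
  assume "\<not> ?thesis"
  then obtain p where p: "p \<in> sector a b m w r j" "p \<in> sector a b m w' r' k" by blast
  let ?x = "p \<bullet> a" and ?y = "p \<bullet> b"
  have "\<bar>real_of_int j - real_of_int k\<bar> * \<bar>?x\<bar> = \<bar>(m * ?y - k * ?x) - (m * ?y - j * ?x)\<bar>"
    by (simp add: abs_mult[symmetric] algebra_simps)
  also have "\<dots> < (w + w') * \<bar>?x\<bar>"
    using p abs_triangle_ineq4[of "m * ?y - k * ?x" "m * ?y - j * ?x"]
    unfolding sector_def mem_Collect_eq distrib_right by linarith
  also have "\<dots> \<le> \<bar>real_of_int j - real_of_int k\<bar> * \<bar>?x\<bar>"
    using assms by (intro mult_right_mono) auto
  finally show False by simp
qed

lemma sectors_swap_disjoint: "sector a b m w r j \<inter> sector b a m w' r' k = {}"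
  by (auto simp: sector_def)

text \<open>With \<open>t = m * y / x\<close>, the intervals of radius \<open>w j\<close> about the
  integers \<open>j\<close> tile the line up to their common endpoints \<open>j + w j\<close>, which
  give the second alternative. This serves both tilings, with \<open>w\<close> equal to
  \<open>width \<epsilon>\<close> for the cube and to 1/2 for the comb.\<close>

lemma slope_cases:
  fixes x y :: real and w :: "int \<Rightarrow> real"
  assumes xy: "\<bar>y\<bar> < \<bar>x\<bar>" and w: "\<And>j. w j + w (j + 1) = 1" "\<And>j. 0 < w j" and m: "0 < m"
  shows "\<exists>j\<in>{- int m..int m}. \<bar>m * y - j * x\<bar> < w j * \<bar>x\<bar> \<or> m * y = (j + w j) * x"
proof -
  define t where "t = m * y / x"
  define j where "j = \<lfloor>t\<rfloor>"
  have x: "x \<noteq> 0" using xy by auto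
  have t: "m * y = t * x" using x by (simp add: t_def)
  have "\<bar>t\<bar> < m" using xy x m by (simp add: t_def abs_mult field_simps)
  then have "- real m < t" "t < m" by auto
  \<comment> \<open>The strict bound \<open>j < int m\<close> keeps the neighbour
    \<open>j + 1\<close>, used in the third case, within the range of indices.\<close>
  then have j: "- int m \<le> j" "j < int m"
    unfolding j_def by (simp_all add: le_floor_iff floor_less_iff)
  have jt: "j \<le> t" "t < j + 1" unfolding j_def by linarith+
  have *: "\<bar>m * y - k * x\<bar> < w k * \<bar>x\<bar> \<longleftrightarrow> \<bar>t - k\<bar> < w k" for k :: int
    using x by (simp add: t abs_mult left_diff_distrib[symmetric])
  consider "t < j + w j" | "t = j + w j" | "t > j + w j" by linarith
  then show ?thesis
  proof cases
    case 1
    then have "\<bar>t - j\<bar> < w j" using jt by simp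
    then show ?thesis using j * by (intro bexI[of _ j]) auto
  next
    case 2
    then show ?thesis using j t by (intro bexI[of _ j]) auto
  next
    case 3
    then have "\<bar>t - real_of_int (j + 1)\<bar> < w (j + 1)" using jt w(1)[of j] by simp
    then show ?thesis using j *[of "j + 1"] by (intro bexI[of _ "j + 1"]) auto
  qed
qed

text \<open>By the addition formula, \<open>cos (pi * t)\<close> is the sign
  \<open>cos (pi * j)\<close> times the positive number \<open>cos (pi * (t - j))\<close>.\<close>

lemma cos_pi_neg_iff_odd:
  fixes t :: real and j :: int
  assumes "\<bar>t - j\<bar> < 1 / 2"
  shows "cos (pi * t) < 0 \<longleftrightarrow> odd j"
proof -
  have "0 < cos (pi * (t - j))"
  proof (rule cos_gt_zero_pi)
    have "pi * \<bar>t - j\<bar> < pi * (1 / 2)" using assms pi_gt_zero by (intro mult_strict_left_mono) auto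
    then have "\<bar>pi * (t - j)\<bar> < pi / 2" by (simp add: abs_mult)
    then show "- (pi / 2) < pi * (t - j)" "pi * (t - j) < pi / 2" by linarith+
  qed
  moreover have "cos (pi * t) = cos (pi * j) * cos (pi * (t - j))"
    using cos_add[of "pi * j" "pi * (t - j)"] by (simp add: algebra_simps)
  ultimately show ?thesis by (simp add: mult_less_0_iff)
qed

text \<open>Here the folded slope is \<open>\<bar>y / x\<bar>\<close>, and the absolute value
  disappears because the cosine is even.\<close>

lemma comb_slope:
  fixes x y :: real
  assumes xy: "\<bar>y\<bar> < \<bar>x\<bar>" and s: "\<bar>m * y - real_of_int j * x\<bar> < 1 / 2 * \<bar>x\<bar>"
  shows "cos (pi * (real m * (min \<bar>x\<bar> \<bar>y\<bar> / max \<bar>x\<bar> \<bar>y\<bar>))) < 0 \<longleftrightarrow> odd j"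
proof -
  have x: "x \<noteq> 0" using xy by auto
  have "\<bar>m * y / x - j\<bar> * \<bar>x\<bar> = \<bar>m * y - j * x\<bar>"
    using x by (simp add: abs_mult[symmetric] left_diff_distrib)
  then have "\<bar>m * y / x - j\<bar> < 1 / 2" using s x by (metis mult_less_cancel_right_pos zero_less_abs_iff)
  from cos_pi_neg_iff_odd[OF this] have "cos (pi * (m * y / x)) < 0 \<longleftrightarrow> odd j" .
  moreover have "\<bar>pi * (m * y / x)\<bar> = pi * (real m * (min \<bar>x\<bar> \<bar>y\<bar> / max \<bar>x\<bar> \<bar>y\<bar>))"
    using xy by (simp add: abs_mult min_def max_def)
  ultimately show ?thesis using cos_abs_real[of "pi * (m * y / x)"] by metis
qed

lemma sector_subset_comb:
  assumes "0 < \<epsilon>"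
  shows "sector a b m (1 / 2) (reach \<epsilon> j) j \<subseteq> comb a b m \<epsilon>"
proof
  fix p assume p: "p \<in> sector a b m (1 / 2) (reach \<epsilon> j) j"
  then have *: "\<bar>p \<bullet> b\<bar> < \<bar>p \<bullet> a\<bar>" "\<bar>m * (p \<bullet> b) - real_of_int j * (p \<bullet> a)\<bar> < 1 / 2 * \<bar>p \<bullet> a\<bar>"
    by (auto simp: sector_def)
  show "p \<in> comb a b m \<epsilon>"
  proof (cases "odd j")
    case True
    then show ?thesis using p comb_slope[OF *] by (auto simp: comb_def sector_def)
  next
    case False
    then show ?thesis using p * by (auto simp: comb_def sector_def reach_def)
  qed
qed

text \<open>Off the dividing lines, \<open>p\<close> has slope near some \<open>j / m\<close>. If
  \<open>j\<close> is even, the cosine is not negative, so \<open>p\<close> must lie in the small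
  square, which is the bound \<open>reach \<epsilon> j\<close>.\<close>

lemma comb_subset_sectors:
  fixes a b :: "'a::euclidean_space"
  assumes p: "p \<in> comb a b m \<epsilon>" and xy: "\<bar>p \<bullet> b\<bar> < \<bar>p \<bullet> a\<bar>" and m: "0 < m" and a: "a \<in> Basis"
  shows "\<exists>j\<in>{- int m..int m}. p \<in> sector a b m (1 / 2) (reach \<epsilon> j) j \<or>
    m * (p \<bullet> b) = (j + 1 / 2) * (p \<bullet> a)"
proof -
  obtain j where j: "j \<in> {- int m..int m}"
    "\<bar>m * (p \<bullet> b) - j * (p \<bullet> a)\<bar> < 1 / 2 * \<bar>p \<bullet> a\<bar> \<or> m * (p \<bullet> b) = (j + 1 / 2) * (p \<bullet> a)"
    using slope_cases[OF xy, of "\<lambda>_. 1 / 2" m] m by auto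
  have "p \<in> sector a b m (1 / 2) (reach \<epsilon> j) j"
    if s: "\<bar>m * (p \<bullet> b) - j * (p \<bullet> a)\<bar> < 1 / 2 * \<bar>p \<bullet> a\<bar>"
    using comb_slope[OF xy s] p xy s a by (auto simp: comb_def sector_def reach_def mem_box_One)
  then show ?thesis using j by blast
qed

lemma null_sets_hyperplane_pair:
  fixes a b :: "'a::euclidean_space"
  assumes "a \<in> Basis" "b \<in> Basis" "a \<noteq> b" "d \<noteq> 0"
  shows "{p. d * (p \<bullet> b) = c * (p \<bullet> a)} \<in> null_sets lborel"
proof -
  let ?n = "d *\<^sub>R b - c *\<^sub>R a"
  have eq: "{p. d * (p \<bullet> b) = c * (p \<bullet> a)} = {p. ?n \<bullet> p = 0}"
    by (auto simp: inner_simps inner_commute)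
  have "?n \<bullet> b = d" using assms by (simp add: inner_simps inner_Basis)
  then have "?n \<noteq> 0" using assms(4) by auto
  then have "negligible {p. ?n \<bullet> p = 0}" by (intro negligible_hyperplane) simp
  moreover have "{p. ?n \<bullet> p = 0} \<in> sets lborel" by (simp add: closed_hyperplane)
  ultimately show ?thesis
    unfolding eq negligible_iff_null_sets by (simp add: null_sets_completion_iff)
qed

section \<open>Combs are star-shaped regions\<close>

lemma box_One_star_region: "box (- One) One \<in> (star_regions :: 'a::euclidean_space set set)"
proof -
  have ne: "box (- One) (One :: 'a) \<noteq> {}" and 0: "0 \<in> box (- One) (One :: 'a)"
    by (auto simp: mem_box_One box_ne_empty)
  have "interior (closure (box (- One) (One :: 'a))) = box (- One) One"
    using ne by (simp add: closure_box interior_cbox)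
  moreover have "closed_segment 0 x \<subseteq> box (- One) One" if "x \<in> box (- One) One" for x :: 'a
    using 0 that convex_box closed_segment_subset by blast
  ultimately show ?thesis
    using ne 0 by (simp add: star_regions_def region_def star_shaped_at_def bounded_box open_box)
qed

lemma continuous_on_comb_cos:
  "continuous_on {p::'a::euclidean_space. 0 < max \<bar>p \<bullet> a\<bar> \<bar>p \<bullet> b\<bar>}
    (\<lambda>p. cos (pi * (real m * (min \<bar>p \<bullet> a\<bar> \<bar>p \<bullet> b\<bar> / max \<bar>p \<bullet> a\<bar> \<bar>p \<bullet> b\<bar>))))"
  by (intro continuous_intros) auto

lemma open_max_less:
  "open {p::'a::euclidean_space. max \<bar>p \<bullet> a\<bar> \<bar>p \<bullet> b\<bar> < c}"
  "open {p::'a::euclidean_space. c < max \<bar>p \<bullet> a\<bar> \<bar>p \<bullet> b\<bar>}"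
  by (intro open_Collect_less continuous_intros)+

text \<open>The cosine is continuous wherever the maximum is positive. Where the maximum vanishes
  the cosine is 1, so the set where it is negative avoids these points.\<close>

lemma open_comb:
  fixes a b :: "'a::euclidean_space"
  shows "open (comb a b m \<epsilon>)"
proof -
  let ?G = "\<lambda>p. max \<bar>p \<bullet> a\<bar> \<bar>p \<bullet> b\<bar>"
  let ?C = "\<lambda>p. cos (pi * (real m * (min \<bar>p \<bullet> a\<bar> \<bar>p \<bullet> b\<bar> / ?G p)))"
  have "open ({p. 0 < ?G p} \<inter> ?C -` {..<0})"
    by (rule continuous_open_preimage[OF continuous_on_comb_cos open_max_less(2)]) simp
  moreover have "comb a b m \<epsilon> = box (- One) One \<inter> ({p. ?G p < \<epsilon>} \<union> ({p. 0 < ?G p} \<inter> ?C -` {..<0}))"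
  proof -
    have "0 < ?G p" if "?C p < 0" for p
    proof (rule ccontr)
      assume "\<not> 0 < ?G p"
      then have "p \<bullet> a = 0" "p \<bullet> b = 0" by (simp_all add: less_max_iff_disj)
      then show False using that by simp
    qed
    then show ?thesis unfolding comb_def by blast
  qed
  ultimately show ?thesis
    using open_max_less(1)[of a b \<epsilon>] by (simp add: open_Int open_Un open_box)
qed

text \<open>A point \<open>p\<close> of the cube outside the comb is moved outwards, and if it lies on a face of a
  tooth also sideways: the sign \<open>\<sigma>\<close> is chosen so that the cosine becomes positive.\<close>

lemma comb_complement_approach:
  fixes a b :: "'a::euclidean_space"
  assumes ab: "a \<in> Basis" "b \<in> Basis" "a \<noteq> b" and \<epsilon>: "0 < \<epsilon>"
    and p: "p \<in> box (- One) One" "p \<notin> comb a b m \<epsilon>" and le: "\<bar>p \<bullet> b\<bar> \<le> \<bar>p \<bullet> a\<bar>"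
  defines "G \<equiv> \<lambda>p. max \<bar>p \<bullet> a\<bar> \<bar>p \<bullet> b\<bar>"
  defines "C \<equiv> \<lambda>p. cos (pi * (real m * (min \<bar>p \<bullet> a\<bar> \<bar>p \<bullet> b\<bar> / G p)))"
  shows "p \<in> closure {q. \<epsilon> < G q \<and> 0 < C q}"
proof -
  let ?W = "{q. \<epsilon> < G q \<and> 0 < C q}"
  define t where "t = \<bar>p \<bullet> b\<bar> / \<bar>p \<bullet> a\<bar>"
  have G: "\<epsilon> \<le> \<bar>p \<bullet> a\<bar>" and C: "0 \<le> cos (pi * (m * t))"
    using p le by (auto simp: comb_def t_def max_def min_def not_less split: if_splits)
  have pa: "0 < \<bar>p \<bullet> a\<bar>" using G \<epsilon> by linarith
  have t: "0 \<le> t" "t \<le> 1" using le pa by (auto simp: t_def)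
  \<comment> \<open>To first order, stretching the slope by \<open>1 + \<sigma> * d\<close> changes
    the cosine by \<open>d * (pi * (m * t))\<close> times the square of the sine, which is
    nonnegative. The factor \<open>1 + d\<close> in \<open>q\<close> pushes the maximum above
    \<open>\<epsilon>\<close>.\<close>
  define \<sigma> where "\<sigma> = - sin (pi * (m * t))"
  define q where "q d = (1 + d) *\<^sub>R (p + (\<sigma> * d * (p \<bullet> b)) *\<^sub>R b)" for d
  have qa: "q d \<bullet> a = (1 + d) * (p \<bullet> a)" and qb: "q d \<bullet> b = (1 + d) * ((1 + \<sigma> * d) * (p \<bullet> b))" for d
    using ab by (simp_all add: q_def inner_simps inner_Basis algebra_simps)
  have lim: "(q \<longlongrightarrow> p) (at_right 0)"
    unfolding q_def by (rule tendsto_eq_intros refl | simp)+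
  have \<sigma>: "\<bar>\<sigma>\<bar> \<le> 1" by (simp add: \<sigma>_def)
  have CT: "0 < C (q d) \<longleftrightarrow> 0 < cos (pi * (m * ((1 + \<sigma> * d) * t)))" and GT: "\<epsilon> < G (q d)"
    if d: "0 < d" "d < 1" and le': "(1 + \<sigma> * d) * t \<le> 1" for d
  proof -
    have "\<bar>\<sigma> * d\<bar> \<le> 1 * d" unfolding abs_mult using \<sigma> d by (intro mult_mono) auto
    then have pos: "0 < 1 + \<sigma> * d" using d by linarith
    have "(1 + \<sigma> * d) * t * \<bar>p \<bullet> a\<bar> \<le> 1 * \<bar>p \<bullet> a\<bar>"
      using le' by (rule mult_right_mono) simp
    then have "(1 + \<sigma> * d) * \<bar>p \<bullet> b\<bar> \<le> \<bar>p \<bullet> a\<bar>" using pa by (simp add: t_def)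
    then have l: "\<bar>q d \<bullet> b\<bar> \<le> \<bar>q d \<bullet> a\<bar>"
      unfolding qa qb abs_mult using d pos by (intro mult_left_mono) auto
    have ratio: "\<bar>q d \<bullet> b\<bar> / \<bar>q d \<bullet> a\<bar> = (1 + \<sigma> * d) * t"
      using d pos by (simp add: qa qb abs_mult t_def)
    have "min \<bar>q d \<bullet> a\<bar> \<bar>q d \<bullet> b\<bar> = \<bar>q d \<bullet> b\<bar>" "max \<bar>q d \<bullet> a\<bar> \<bar>q d \<bullet> b\<bar> = \<bar>q d \<bullet> a\<bar>"
      using l by auto
    then show "0 < C (q d) \<longleftrightarrow> 0 < cos (pi * (m * ((1 + \<sigma> * d) * t)))"
      by (simp only: C_def G_def ratio)
    have "1 * \<bar>p \<bullet> a\<bar> < (1 + d) * \<bar>p \<bullet> a\<bar>" using d pa by (intro mult_strict_right_mono) auto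
    then have "\<epsilon> < \<bar>q d \<bullet> a\<bar>" using d G by (simp add: qa abs_mult)
    then show "\<epsilon> < G (q d)" by (simp add: G_def)
  qed
  have ev: "\<forall>\<^sub>F d in at_right 0. 0 < d \<and> d < (1::real)"
    by (rule eventually_at_rightI[of 0 1]) auto
  have "\<forall>\<^sub>F d in at_right 0. (1 + \<sigma> * d) * t \<le> 1 \<and> 0 < cos (pi * (m * ((1 + \<sigma> * d) * t)))"
  \<comment> \<open>On a diagonal a larger slope would exchange the two coordinates. There the sine
    vanishes, so \<open>\<sigma>\<close> is 0, and the cosine, being nonnegative and nonzero, is
    already positive.\<close>
  proof (cases "t = 1")
    case True
    then have "\<sigma> = 0" using sin_npi_int[of "int m"] by (simp add: \<sigma>_def)
    moreover have "cos (pi * m) \<noteq> 0" using cos_npi_int[of "int m"] by (simp split: if_splits)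
    ultimately have "0 < cos (pi * m)" using C True unfolding less_le by simp
    with \<open>\<sigma> = 0\<close> show ?thesis using True by simp
  next
    case False
    have "((\<lambda>d. (1 + \<sigma> * d) * t) \<longlongrightarrow> t) (at_right 0)"
      by (rule tendsto_eq_intros refl | simp)+
    then have 1: "\<forall>\<^sub>F d in at_right 0. (1 + \<sigma> * d) * t < 1"
      by (rule order_tendstoD) (use t False in simp)
    have 2: "\<forall>\<^sub>F d in at_right 0. 0 < cos (pi * (m * ((1 + \<sigma> * d) * t)))"
    proof (cases "cos (pi * (m * t)) = 0")
      case True
      \<comment> \<open>On a face of a tooth \<open>\<sigma>\<close> is 1 or -1, and the new cosine
        is exactly \<open>sin (d * (pi * (m * t)))\<close>.\<close>
      then have s2: "\<sigma> * \<sigma> = 1"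
        using sin_cos_squared_add[of "pi * (m * t)"] by (simp add: \<sigma>_def power2_eq_square)
      have mt: "0 < m * t" using True t by (cases "m * t = 0") auto
      have "((\<lambda>d. d * (pi * (m * t))) \<longlongrightarrow> 0) (at_right 0)"
        by (rule tendsto_eq_intros refl | simp)+
      then have "\<forall>\<^sub>F d in at_right 0. d * (pi * (m * t)) < pi"
        by (rule order_tendstoD) simp
      then show ?thesis using ev
      proof eventually_elim
        case (elim d)
        let ?u = "pi * (m * t)"
        have "cos (?u + \<sigma> * (d * ?u)) = \<sigma> * sin (\<sigma> * (d * ?u))"
          unfolding cos_add True by (simp add: \<sigma>_def)
        also have "\<dots> = sin (d * ?u)"
          using s2 by (auto simp: square_eq_1_iff)
        also have "\<dots> > 0" using elim mt by (intro sin_gt_zero) auto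
        finally show ?case by (simp add: algebra_simps)
      qed
    next
      case False
      have "((\<lambda>d. cos (pi * (m * ((1 + \<sigma> * d) * t)))) \<longlongrightarrow> cos (pi * (m * t))) (at_right 0)"
        by (rule tendsto_eq_intros refl | simp)+
      then show ?thesis
        by (rule order_tendstoD) (use C False in simp)
    qed
    show ?thesis using 1 2 by eventually_elim simp
  qed
  with ev have "\<forall>\<^sub>F d in at_right 0. q d \<in> closure ?W"
  proof eventually_elim
    case (elim d)
    then have "q d \<in> ?W" using CT[of d] GT[of d] by blast
    then show ?case using closure_subset by (rule set_mp[rotated])
  qed
  then show ?thesis
    using Lim_in_closed_set[OF closed_closure _ _ lim] by simp
qed

text \<open>Regularity: a point of the cube outside the comb lies in the closure of the open set
  \<open>?W\<close>, which is disjoint from the comb, so it is not interior to the closure of the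
  comb. Star shape: along a ray the folded slope is constant and the maximum shrinks towards the
  origin.\<close>

lemma comb_star_region:
  fixes a b :: "'a::euclidean_space"
  assumes ab: "a \<in> Basis" "b \<in> Basis" "a \<noteq> b" and \<epsilon>: "0 < \<epsilon>"
  shows "comb a b m \<epsilon> \<in> star_regions"
proof -
  let ?G = "\<lambda>p. max \<bar>p \<bullet> a\<bar> \<bar>p \<bullet> b\<bar>"
  let ?C = "\<lambda>p. cos (pi * (real m * (min \<bar>p \<bullet> a\<bar> \<bar>p \<bullet> b\<bar> / ?G p)))"
  let ?Q = "comb a b m \<epsilon>" and ?W = "{q. \<epsilon> < ?G q \<and> 0 < ?C q}"
  have sub: "?Q \<subseteq> box (- One) One" by (auto simp: comb_def)
  have 0: "0 \<in> ?Q" using \<epsilon> by (simp add: comb_def mem_box_One)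
  have "open ({p. 0 < ?G p} \<inter> ?C -` {0<..})"
    by (rule continuous_open_preimage[OF continuous_on_comb_cos open_max_less(2)]) simp
  then have "open ({p. \<epsilon> < ?G p} \<inter> ({p. 0 < ?G p} \<inter> ?C -` {0<..}))"
    by (rule open_Int[OF open_max_less(2)])
  also have "{p. \<epsilon> < ?G p} \<inter> ({p. 0 < ?G p} \<inter> ?C -` {0<..}) = ?W"
    using \<epsilon> by auto
  finally have W: "open ?W" .
  have "?W \<inter> ?Q = {}" by (auto simp: comb_def)
  then have WQ: "?W \<inter> closure ?Q = {}" using open_Int_closure_eq_empty[OF W] by blast
  have "interior (closure ?Q) \<subseteq> ?Q"
  proof
    fix p assume p: "p \<in> interior (closure ?Q)"
    have "interior (closure ?Q) \<subseteq> interior (closure (box (- One) One))"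
      by (intro interior_mono closure_mono sub)
    then have box: "p \<in> box (- One) One"
      using p box_One_star_region by (auto simp: star_regions_def region_def)
    show "p \<in> ?Q"
    proof (rule ccontr)
      assume np: "p \<notin> ?Q"
      have "p \<in> closure ?W"
      proof (cases "\<bar>p \<bullet> b\<bar> \<le> \<bar>p \<bullet> a\<bar>")
        case True
        then show ?thesis using comb_complement_approach[OF ab \<epsilon> box np] by simp
      next
        case False
        then show ?thesis
          using comb_complement_approach[OF ab(2,1) ab(3)[symmetric] \<epsilon> box, of m] np
          by (simp add: comb_commute[of a] max.commute[of "\<bar>_ \<bullet> a\<bar>"] min.commute[of "\<bar>_ \<bullet> a\<bar>"])
      qed
      then have "interior (closure ?Q) \<inter> ?W \<noteq> {}"
        using p open_Int_closure_eq_empty[OF open_interior, of "closure ?Q" ?W] by blast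
      then show False using WQ interior_subset by blast
    qed
  qed
  then have reg: "?Q = interior (closure ?Q)"
    using interior_maximal[OF closure_subset open_comb] by (intro antisym)
  have seg: "closed_segment 0 p \<subseteq> ?Q" if p: "p \<in> ?Q" for p
  proof
    fix x assume "x \<in> closed_segment 0 p"
    then obtain s where s: "0 \<le> s" "s \<le> 1" and x: "x = s *\<^sub>R p"
      by (auto simp: in_segment)
    have "closed_segment 0 p \<subseteq> box (- One) One"
      using p 0 sub by (intro closed_segment_subset convex_box) auto
    then have xb: "x \<in> box (- One) One" using \<open>x \<in> closed_segment 0 p\<close> by blast
    have mx: "max (s * u) (s * v) = s * max u v" "min (s * u) (s * v) = s * min u v" for u v :: real
      using s by (simp_all add: max_mult_distrib_left min_mult_distrib_left)
    have G: "?G x = s * ?G p" and M: "min \<bar>x \<bullet> a\<bar> \<bar>x \<bullet> b\<bar> = s * min \<bar>p \<bullet> a\<bar> \<bar>p \<bullet> b\<bar>"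
      using s by (simp_all add: x abs_mult mx)
    show "x \<in> ?Q"
    \<comment> \<open>The common factor \<open>s\<close> cancels in the folded slope only if it is
      nonzero.\<close>
    proof (cases "s = 0")
      case True
      then show ?thesis using 0 x by simp
    next
      case False
      have Gx: "?G x \<le> ?G p"
        unfolding G using s by (intro mult_left_le_one_le) auto
      have Cx: "?C x = ?C p" unfolding G M using False by simp
      have "?G p < \<epsilon> \<or> ?C p < 0" using p by (simp only: comb_def mem_Collect_eq)
      then have "?G x < \<epsilon> \<or> ?C x < 0"
        unfolding Cx by (rule disj_mono[THEN mp, rotated 2]) (rule impI le_less_trans[OF Gx] | assumption)+
      then show ?thesis using xb by (simp only: comb_def mem_Collect_eq simp_thms)
    qed
  qed
  have "bounded ?Q" using sub bounded_box bounded_subset by blast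
  then show ?thesis
    using 0 reg open_comb[of a b m \<epsilon>] seg
    unfolding star_regions_def region_def star_shaped_at_def by blast
qed

section \<open>Transport from the cube to a comb\<close>

text \<open>Stretching the \<open>a\<close>-coordinate by \<open>1 / \<epsilon>\<close> carries the
  slab onto the cube.\<close>

lemma emeasure_slab:
  fixes a :: "'a::euclidean_space"
  assumes ab: "a \<in> Basis" "b \<in> Basis" "a \<noteq> b" and \<epsilon>: "0 < \<epsilon>" "\<epsilon> \<le> 1"
  shows "emeasure lborel {p \<in> box (- One) One. \<bar>p \<bullet> a\<bar> < \<epsilon>} = \<epsilon> * emeasure lborel (box (- One) (One :: 'a))"
proof -
  let ?T = "plane_map a b (1 / \<epsilon>) 0 1"
  have Ta: "\<bar>?T p \<bullet> a\<bar> < 1 \<longleftrightarrow> \<bar>p \<bullet> a\<bar> < \<epsilon>" for p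
    using \<epsilon> by (simp add: plane_map_inner(1)[OF ab] abs_mult)
  have Tk: "?T p \<bullet> k = p \<bullet> k" if "k \<in> Basis" "k \<noteq> a" for p k
    using plane_map_inner(2,3)[OF ab] that by (cases "k = b") auto
  have "{p \<in> box (- One) One. \<bar>p \<bullet> a\<bar> < \<epsilon>} = ?T -` box (- One) One"
  proof (intro set_eqI)
    fix p
    have split: "(\<forall>k\<in>Basis. R k) \<longleftrightarrow> R a \<and> (\<forall>k\<in>Basis - {a}. R k)" for R
      using ab(1) by blast
    have "(\<forall>k\<in>Basis - {a}. \<bar>?T p \<bullet> k\<bar> < 1) \<longleftrightarrow> (\<forall>k\<in>Basis - {a}. \<bar>p \<bullet> k\<bar> < 1)"
      using Tk by simp
    then have "(\<forall>k\<in>Basis. \<bar>?T p \<bullet> k\<bar> < 1) \<longleftrightarrow> (\<forall>k\<in>Basis. \<bar>p \<bullet> k\<bar> < 1) \<and> \<bar>p \<bullet> a\<bar> < \<epsilon>"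
      unfolding split Ta using \<epsilon> by linarith
    then show "p \<in> {p \<in> box (- One) One. \<bar>p \<bullet> a\<bar> < \<epsilon>} \<longleftrightarrow> p \<in> ?T -` box (- One) One"
      by (simp add: mem_box_One)
  qed
  then show ?thesis
    using emeasure_plane_map_vimage[OF ab, of "box (- One) One" "1 / \<epsilon>" 1 0] \<epsilon> by simp
qed

lemma sector_borel: "sector a b m w r j \<in> sets borel"
  unfolding sector_def by measurable

lemma emeasure_box_One:
  "emeasure lborel (box (- One) (One :: 'a::euclidean_space)) = ennreal (measure lborel (box (- One) (One :: 'a)))"
  "0 < measure lborel (box (- One) (One :: 'a::euclidean_space))"
proof -
  show 1: "emeasure lborel (box (- One) (One :: 'a)) = ennreal (measure lborel (box (- One) (One :: 'a)))"
    using emeasure_bounded_finite[OF bounded_box, of "- One" "One :: 'a"]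
    by (intro emeasure_eq_ennreal_measure) auto
  show "0 < measure lborel (box (- One) (One :: 'a))"
    by (subst measure_lborel_box_eq) (auto simp: inner_simps intro!: prod_pos)
qed

text \<open>The exceptional set \<open>F\<close> is the union of the even source sectors. Its volume
  is computed on the image side, where these sectors fill only gaps inside a slab of relative volume
  \<open>\<epsilon>\<close>.\<close>

lemma comb_transport:
  fixes a b :: "'a::euclidean_space"
  assumes ab: "a \<in> Basis" "b \<in> Basis" "a \<noteq> b" and \<epsilon>: "0 < \<epsilon>" "\<epsilon> \<le> 1" and m: "0 < m"
  defines "P \<equiv> box (- One) (One :: 'a)"
  obtains \<gamma> F where "\<gamma> \<in> transport_maps P (comb a b m \<epsilon>)"
    and "emeasure lborel P = ennreal (2 / (1 + \<epsilon>\<^sup>2)) * emeasure lborel (comb a b m \<epsilon>)"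
    and "F \<in> sets borel" "emeasure lborel F \<le> ennreal (2 * \<epsilon>) * emeasure lborel P"
    and "AE p in lborel. p \<in> P \<longrightarrow> \<gamma> p \<in> P \<and> (p \<in> F \<or> dist p (\<gamma> p) \<le> 1 / m)"
proof -
  \<comment> \<open>The two orders of the axes: the dominant coordinate of a point decides which one
    applies.\<close>
  define D where "D = {(a, b), (b, a)}"
  define I where "I = D \<times> {- int m..int m}"
  define A where "A i = (case i of ((x, y), j) \<Rightarrow> sector x y m (width \<epsilon> j) 1 j)" for i :: "('a \<times> 'a) \<times> int"
  define B where "B i = (case i of ((x, y), j) \<Rightarrow> sector x y m (1 / 2) (reach \<epsilon> j) j)" for i :: "('a \<times> 'a) \<times> int"
  define L where "L i = (case i of ((x, y), j) \<Rightarrow> sector_map x y m \<epsilon> j)" for i :: "('a \<times> 'a) \<times> int"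
  define \<gamma> where "\<gamma> = (\<lambda>p. \<Sum>i\<in>I. indicator (A i) p *\<^sub>R L i p)"
  define J where "J = {i \<in> I. even (snd i)}"
  define F where "F = (\<Union>i\<in>J. A i)"
  let ?Q = "comb a b m \<epsilon>" and ?c = "2 / (1 + \<epsilon>\<^sup>2)"
  have c: "0 < ?c" using one_plus_square_pos[of \<epsilon>] by simp
  have D: "x \<in> Basis" "y \<in> Basis" "x \<noteq> y" "comb x y m \<epsilon> = ?Q" if "(x, y) \<in> D" for x y
    using that ab comb_commute[of a b m \<epsilon>] by (auto simp: D_def)
  have finI: "finite I" by (simp add: I_def D_def)
  have finJ: "finite J" and JI: "J \<subseteq> I" using finI by (auto simp: J_def)
  have A_meas: "A i \<in> sets borel" and B_meas: "B i \<in> sets borel" for i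
    by (auto simp: A_def B_def sector_borel split: prod.split)
  have disj: "S i \<inter> S k = {}"
    if w: "\<And>j k. j \<noteq> k \<Longrightarrow> w j + w k \<le> \<bar>real_of_int j - real_of_int k\<bar>"
      and S: "\<And>x y j. S ((x, y), j) = sector x y m (w j) (r j) j" and "i \<in> I" "k \<in> I" "i \<noteq> k"
    for w r :: "int \<Rightarrow> real" and S i k
  proof -
    obtain x y j where i: "i = ((x, y), j)" "(x, y) \<in> D"
      using \<open>i \<in> I\<close> by (auto simp: I_def)
    obtain x' y' j' where k: "k = ((x', y'), j')" "(x', y') \<in> D"
      using \<open>k \<in> I\<close> by (auto simp: I_def)
    consider "x' = x" "y' = y" "j \<noteq> j'" | "x' = y" "y' = x"
      using i k \<open>i \<noteq> k\<close> by (auto simp: D_def)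
    then show ?thesis
      by cases (simp_all add: i(1) k(1) S sectors_disjoint[OF w] sectors_swap_disjoint)
  qed
  have A_disj: "disjoint_family_on A I"
    unfolding disjoint_family_on_def
    using disj[OF width_separated[OF \<epsilon>(1)], of A "\<lambda>_. 1"] by (simp add: A_def)
  have half: "1 / 2 + 1 / 2 \<le> \<bar>real_of_int j - real_of_int k\<bar>" if "j \<noteq> k" for j k
  proof -
    have "1 \<le> \<bar>j - k\<bar>" using that by linarith
    then show ?thesis by linarith
  qed
  have B_disj: "disjoint_family_on B I"
    unfolding disjoint_family_on_def
    using disj[of "\<lambda>_. 1 / 2" B "reach \<epsilon>", OF half] by (simp add: B_def)
  have AP: "(\<Union>i\<in>I. A i) \<subseteq> P" by (auto simp: A_def P_def sector_def split: prod.splits)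
  have BQ: "(\<Union>i\<in>I. B i) \<subseteq> ?Q"
  proof (rule UN_least)
    fix i assume "i \<in> I"
    then obtain x y j where i: "i = ((x, y), j)" "(x, y) \<in> D" by (auto simp: I_def)
    show "B i \<subseteq> ?Q"
      using sector_subset_comb[OF \<epsilon>(1), of x y m j] D(4)[OF i(2)] by (simp add: i(1) B_def)
  qed
  \<comment> \<open>The diagonals together with the walls between sectors of half-widths
    \<open>w\<close>. It contains all points missed by the tiling of the cube or of the comb,
    according to \<open>w\<close>.\<close>
  define N where "N w = (\<Union>(x, y)\<in>D. {p. 1 * (p \<bullet> y) = 1 * (p \<bullet> x)} \<union> {p. 1 * (p \<bullet> y) = - 1 * (p \<bullet> x)} \<union>
     (\<Union>j\<in>{- int m..int m}. {p. m * (p \<bullet> y) = (j + w j) * (p \<bullet> x)}))" for w :: "int \<Rightarrow> real"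
  have N: "N w \<in> null_sets lborel" for w
    unfolding N_def
  proof (rule null_sets_UN', simp add: D_def, clarify)
    fix x y assume xy: "(x, y) \<in> D"
    note hp = null_sets_hyperplane_pair[OF D(1-3)[OF xy]]
    show "{p. 1 * (p \<bullet> y) = 1 * (p \<bullet> x)} \<union> {p. 1 * (p \<bullet> y) = - 1 * (p \<bullet> x)} \<union>
     (\<Union>j\<in>{- int m..int m}. {p. m * (p \<bullet> y) = (j + w j) * (p \<bullet> x)}) \<in> null_sets lborel"
      using m by (intro null_sets.Un null_sets_UN' hp) auto
  qed
  have NI: "p \<in> N w" if "(x, y) \<in> D" "j \<in> {- int m..int m}" "m * (p \<bullet> y) = (j + w j) * (p \<bullet> x)" for p x y j w
    unfolding N_def using that by (intro UN_I[of "(x, y)"]) auto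
  have order: "\<exists>(x, y)\<in>D. \<bar>p \<bullet> y\<bar> < \<bar>p \<bullet> x\<bar>" if "p \<notin> N w" for p w
  proof -
    have "p \<bullet> b \<noteq> p \<bullet> a" "p \<bullet> b \<noteq> - (p \<bullet> a)" using that by (auto simp: N_def D_def)
    then have "\<bar>p \<bullet> b\<bar> < \<bar>p \<bullet> a\<bar> \<or> \<bar>p \<bullet> a\<bar> < \<bar>p \<bullet> b\<bar>" by (auto simp: abs_if split: if_splits)
    then show ?thesis by (auto simp: D_def)
  qed
  have null: "emeasure lborel (R - S) = 0" if "R - S \<subseteq> N w" "R \<in> sets borel" "S \<in> sets borel" for R S w
    using null_sets_subset[OF N[of w], of "R - S"] that by auto
  have PA: "P - (\<Union>i\<in>I. A i) \<subseteq> N (width \<epsilon>)"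
  proof
    fix p assume p: "p \<in> P - (\<Union>i\<in>I. A i)"
    show "p \<in> N (width \<epsilon>)"
    proof (rule ccontr)
      assume np: "p \<notin> N (width \<epsilon>)"
      then obtain x y where xy: "(x, y) \<in> D" "\<bar>p \<bullet> y\<bar> < \<bar>p \<bullet> x\<bar>" using order by blast
      obtain j where j: "j \<in> {- int m..int m}"
        "\<bar>m * (p \<bullet> y) - j * (p \<bullet> x)\<bar> < width \<epsilon> j * \<bar>p \<bullet> x\<bar> \<or> m * (p \<bullet> y) = (j + width \<epsilon> j) * (p \<bullet> x)"
        using slope_cases[where w = "width \<epsilon>", OF xy(2) width_Suc width_pos[OF \<epsilon>(1)] m] by blast
      have "\<bar>m * (p \<bullet> y) - j * (p \<bullet> x)\<bar> < width \<epsilon> j * \<bar>p \<bullet> x\<bar>"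
        using j(2) np NI[OF xy(1) j(1)] by blast
      then have "p \<in> sector x y m (width \<epsilon> j) 1 j"
        using xy(2) p D(1)[OF xy(1)] by (auto simp: sector_def P_def mem_box_One)
      then have "p \<in> A ((x, y), j)" by (simp add: A_def)
      then show False using p xy j(1) by (auto simp: I_def)
    qed
  qed
  have QB: "?Q - (\<Union>i\<in>I. B i) \<subseteq> N (\<lambda>_. 1 / 2)"
  proof
    fix p assume p: "p \<in> ?Q - (\<Union>i\<in>I. B i)"
    show "p \<in> N (\<lambda>_. 1 / 2)"
    proof (rule ccontr)
      assume np: "p \<notin> N (\<lambda>_. 1 / 2)"
      then obtain x y where xy: "(x, y) \<in> D" "\<bar>p \<bullet> y\<bar> < \<bar>p \<bullet> x\<bar>" using order by blast
      have "p \<in> comb x y m \<epsilon>" using p D(4)[OF xy(1)] by simp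
      from comb_subset_sectors[OF this xy(2) m D(1)[OF xy(1)]]
      obtain j where j: "j \<in> {- int m..int m}"
        "p \<in> sector x y m (1 / 2) (reach \<epsilon> j) j \<or> m * (p \<bullet> y) = (j + 1 / 2) * (p \<bullet> x)" by blast
      have "p \<in> sector x y m (1 / 2) (reach \<epsilon> j) j"
        using j(2) np NI[OF xy(1) j(1), of p "\<lambda>_. 1 / 2"] by blast
      then have "p \<in> B ((x, y), j)" by (simp add: B_def)
      then show False using p xy j(1) by (auto simp: I_def)
    qed
  qed
  have P_meas: "P \<in> sets borel" and Q_meas: "?Q \<in> sets borel"
    using open_comb[of a b m \<epsilon>] by (auto simp: P_def)
  have UA: "(\<Union>i\<in>I. A i) \<in> sets borel" and UB: "(\<Union>i\<in>I. B i) \<in> sets borel"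
    using finI A_meas B_meas by auto
  have P0: "emeasure lborel P \<noteq> 0" "emeasure lborel P \<noteq> \<infinity>"
    unfolding emeasure_box_One(1)[where 'a='a, folded P_def]
    using emeasure_box_One(2)[where 'a='a, folded P_def] by auto
  have L_iff: "p \<in> A i \<longleftrightarrow> L i p \<in> B i" and L_meas: "L i \<in> borel_measurable borel"
    and L_em: "E \<in> sets borel \<Longrightarrow> emeasure lborel (L i -` E) = ennreal ?c * emeasure lborel E"
    if "i \<in> I" for i p E
  proof -
    obtain x y j where i: "i = ((x, y), j)" "(x, y) \<in> D" "\<bar>j\<bar> \<le> int m"
      using \<open>i \<in> I\<close> by (auto simp: I_def)
    show "p \<in> A i \<longleftrightarrow> L i p \<in> B i"
      using sector_map_mem_iff[OF D(1-3)[OF i(2)] m \<epsilon> i(3)] by (simp add: i(1) A_def B_def L_def)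
    show "L i \<in> borel_measurable borel" by (simp add: i(1) L_def sector_map_measurable)
    show "emeasure lborel (L i -` E) = ennreal ?c * emeasure lborel E" if "E \<in> sets borel"
      using emeasure_sector_map_vimage[OF D(1-3)[OF i(2)] that \<epsilon>(1)] by (simp add: i(1) L_def)
  qed
  note transport = piecewise_transport[where A = A and B = B and L = L,
      OF finI c P_meas P0 Q_meas A_meas A_disj AP null[OF PA P_meas UA]
      B_meas B_disj BQ null[OF QB Q_meas UB] L_meas L_iff L_em]
  have tr: "\<gamma> \<in> transport_maps P ?Q" "emeasure lborel P = ennreal ?c * emeasure lborel ?Q"
    "\<And>i p. i \<in> I \<Longrightarrow> p \<in> A i \<Longrightarrow> \<gamma> p = L i p"
    unfolding \<gamma>_def by (rule transport; assumption)+
  have F_meas: "F \<in> sets borel" unfolding F_def using finJ A_meas by auto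
  have slab: "emeasure lborel {p \<in> P. \<bar>p \<bullet> a\<bar> < \<epsilon>} = \<epsilon> * emeasure lborel P"
    unfolding P_def by (rule emeasure_slab[OF ab \<epsilon>])
  have "emeasure lborel F = (\<Sum>i\<in>J. emeasure lborel (A i))"
    unfolding F_def using finJ A_meas disjoint_family_on_mono[OF JI A_disj]
    by (intro sum_emeasure[symmetric]) auto
  also have "\<dots> = (\<Sum>i\<in>J. ennreal ?c * emeasure lborel (B i))"
  proof (rule sum.cong[OF refl])
    fix i assume "i \<in> J"
    then have i: "i \<in> I" using JI by blast
    have "A i = L i -` B i" using L_iff[OF i] by auto
    then show "emeasure lborel (A i) = ennreal ?c * emeasure lborel (B i)"
      using L_em[OF i B_meas] by simp
  qed
  also have "\<dots> = ennreal ?c * emeasure lborel (\<Union>i\<in>J. B i)"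
    using finJ B_meas disjoint_family_on_mono[OF JI B_disj]
    by (subst sum_emeasure[symmetric]) (auto simp: sum_distrib_left)
  \<comment> \<open>An even image sector has its dominant coordinate below
    \<open>\<epsilon>\<close>, hence also its \<open>a\<close>-coordinate, whichever axis
    dominates.\<close>
  also have "\<dots> \<le> ennreal 2 * emeasure lborel {p \<in> P. \<bar>p \<bullet> a\<bar> < \<epsilon>}"
  proof (intro mult_mono emeasure_mono)
    show "ennreal ?c \<le> ennreal 2" by (intro ennreal_leI) (simp add: divide_le_eq one_plus_square_pos)
    show "(\<Union>i\<in>J. B i) \<subseteq> {p \<in> P. \<bar>p \<bullet> a\<bar> < \<epsilon>}"
      by (auto simp: J_def I_def D_def B_def sector_def P_def reach_def)
    show "{p \<in> P. \<bar>p \<bullet> a\<bar> < \<epsilon>} \<in> sets lborel" unfolding P_def by measurable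
  qed auto
  also have "\<dots> = ennreal (2 * \<epsilon>) * emeasure lborel P"
    unfolding slab using \<epsilon> by (simp add: ennreal_mult mult.assoc)
  finally have F_le: "emeasure lborel F \<le> ennreal (2 * \<epsilon>) * emeasure lborel P" .
  have "AE p in lborel. p \<notin> N (width \<epsilon>)" using N by (rule AE_not_in)
  then have AE: "AE p in lborel. p \<in> P \<longrightarrow> \<gamma> p \<in> P \<and> (p \<in> F \<or> dist p (\<gamma> p) \<le> 1 / m)"
  proof eventually_elim
    case (elim p)
    show ?case
    proof
      assume "p \<in> P"
      then obtain i where i: "i \<in> I" "p \<in> A i" using elim PA by blast
      then obtain x y j where xyj: "i = ((x, y), j)" "(x, y) \<in> D" by (auto simp: I_def)
      have g: "\<gamma> p = L i p" by (rule tr(3)[OF i])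
      have "L i p \<in> ?Q" using L_iff[OF i(1)] i BQ by blast
      then have "\<gamma> p \<in> P" by (simp add: g comb_def P_def)
      moreover have "dist p (\<gamma> p) \<le> 1 / m" if "p \<notin> F"
      proof -
        have "odd j" using that i xyj by (auto simp: F_def J_def)
        then show ?thesis
          using dist_sector_map_odd[of p x y m "width \<epsilon> j" j \<epsilon>] i(2) xyj width_less_1[OF \<epsilon>(1), of j] m D(2)[OF xyj(2)] \<epsilon>
          by (simp add: g A_def L_def)
      qed
      ultimately show "\<gamma> p \<in> P \<and> (p \<in> F \<or> dist p (\<gamma> p) \<le> 1 / m)" by blast
    qed
  qed
  show ?thesis by (rule that[OF tr(1,2) F_meas F_le AE])
qed

section \<open>Comparison of the topologies\<close>

text \<open>The intermediate value theorem and unboundedness give surjectivity onto the nonnegative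
  reals, so \<open>inv_into\<close> is a genuine inverse there.\<close>

lemma mulholland_vimage:
  assumes \<psi>: "mulholland \<psi>" and y: "0 \<le> y"
  obtains x where "0 \<le> x" "\<psi> x = y" "inv_into {0..} \<psi> y = x"
proof -
  have "\<forall>\<^sub>F x in at_top. y \<le> \<psi> x \<and> 0 \<le> x"
    using \<psi> eventually_ge_at_top[of 0]
    unfolding mulholland_def filterlim_at_top by (intro eventually_conj) auto
  then obtain z where z: "y \<le> \<psi> z" "0 \<le> z"
    using eventually_happens'[OF trivial_limit_at_top_linorder] by blast
  have "continuous_on {0..z} \<psi>"
    using \<psi> unfolding mulholland_def by (auto intro: continuous_on_subset)
  then obtain x where x: "0 \<le> x" "\<psi> x = y"
    using IVT'[of \<psi> 0 y z] \<psi> y z unfolding mulholland_def by auto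
  have "inj_on \<psi> {0..}"
    using \<psi> unfolding mulholland_def by (blast intro: strict_mono_on_imp_inj_on)
  then have "inv_into {0..} \<psi> y = x"
    using x by (metis atLeast_iff inv_into_f_f)
  with x show ?thesis using that by blast
qed

text \<open>A single map bounds the infimum from above, and monotonicity turns a comparison of
  distances into one of costs.\<close>

lemma wasserstein_dist_less:
  fixes P Q :: "'a::euclidean_space set"
  assumes \<psi>: "mulholland \<psi>" and \<gamma>: "\<gamma> \<in> transport_maps P Q" and r: "0 \<le> r"
    and cost: "1 / measure lborel P * (LINT x:P|lborel. \<psi> (dist x (\<gamma> x))) < \<psi> r"
  shows "wasserstein_dist \<psi> P Q < r"
proof -
  let ?c = "\<lambda>\<gamma>. 1 / measure lborel P * (LINT x:P|lborel. \<psi> (dist x (\<gamma> x)))"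
  have "0 \<le> \<psi> s" if "0 \<le> s" for s using \<psi> that by (auto simp: mulholland_def)
  then have nonneg: "0 \<le> ?c g" for g :: "'a \<Rightarrow> 'a"
    unfolding set_lebesgue_integral_def by (intro mult_nonneg_nonneg integral_nonneg) auto
  have inv_nonneg: "0 \<le> inv_into {0..} \<psi> y" if "0 \<le> y" for y
    using mulholland_vimage[OF \<psi> that] by metis
  have "wasserstein_dist \<psi> P Q \<le> inv_into {0..} \<psi> (?c \<gamma>)"
    unfolding wasserstein_dist_def
    \<comment> \<open>For real numbers the infimum is a lower bound only if the family is bounded
      below, here by 0.\<close>
    by (rule cINF_lower[OF _ \<gamma>]) (intro bdd_belowI2[of _ 0] inv_nonneg nonneg)
  also have "\<dots> < r"
  proof -
    obtain x where x: "0 \<le> x" "\<psi> x = ?c \<gamma>" "inv_into {0..} \<psi> (?c \<gamma>) = x"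
      using mulholland_vimage[OF \<psi> nonneg] .
    have "\<psi> r \<le> \<psi> x" if "r \<le> x"
      using \<psi> r that strict_mono_on_leD[of "{0..}" \<psi> r x] by (simp add: mulholland_def)
    then show ?thesis using cost x by linarith
  qed
  finally show ?thesis .
qed

text \<open>Points outside \<open>F\<close> cost at most \<open>\<psi> (1 / m)\<close> each; points
  of \<open>F\<close> cost at most \<open>\<psi> D\<close>, with \<open>D\<close> the diameter of
  the cube, but form a fraction of at most \<open>2 * \<epsilon>\<close>. First \<open>m\<close> and
  then \<open>\<epsilon>\<close> are chosen to keep the average below
  \<open>\<psi> r\<close>.\<close>

lemma comb_close:
  fixes a b :: "'a::euclidean_space"
  assumes ab: "a \<in> Basis" "b \<in> Basis" "a \<noteq> b" and \<psi>: "mulholland \<psi>" and r: "0 < r"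
  defines "P \<equiv> box (- One) (One :: 'a)"
  shows "\<exists>Q\<in>star_regions. wasserstein_dist \<psi> P Q < r \<and> measure lborel P / 4 < symdiff_dist P Q"
proof -
  have mono: "\<psi> s \<le> \<psi> t" if "0 \<le> s" "s \<le> t" for s t
    using \<psi> that strict_mono_on_leD[of "{0..}" \<psi> s t] by (simp add: mulholland_def)
  have nonneg: "0 \<le> \<psi> s" if "0 \<le> s" for s using \<psi> that by (auto simp: mulholland_def)
  have \<psi>0: "\<psi> 0 = 0" using \<psi> by (simp add: mulholland_def)
  have \<psi>r: "0 < \<psi> r"
    using \<psi> r \<psi>0 strict_mono_onD[of "{0..}" \<psi> 0 r] by (simp add: mulholland_def)
  obtain x where x: "0 \<le> x" "\<psi> x = \<psi> r / 2"
    using mulholland_vimage[OF \<psi>, of "\<psi> r / 2"] \<psi>r by auto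
  have "0 < x" using x \<psi>0 \<psi>r by (cases "x = 0") auto
  then obtain n where n: "inverse (real (Suc n)) < x" using reals_Archimedean by blast
  define m where "m = Suc n"
  have m: "0 < m" and "1 / m \<le> x" using n by (auto simp: m_def inverse_eq_divide)
  then have \<psi>m: "\<psi> (1 / m) \<le> \<psi> r / 2" using mono[of "1 / m" x] x(2) by simp
  define D where "D = diameter P"
  have bP: "bounded P" by (simp add: P_def bounded_box)
  have D: "0 \<le> D" and dist_D: "\<And>p q. p \<in> P \<Longrightarrow> q \<in> P \<Longrightarrow> dist p q \<le> D"
    using diameter_ge_0[OF bP] diameter_bounded_bound[OF bP] by (auto simp: D_def)
  have \<psi>D: "0 \<le> \<psi> D" using nonneg D by simp
  \<comment> \<open>The bound 1/2 leaves the comb at most 5/8 of the cube; the other bound gives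
    \<open>2 * \<epsilon> * \<psi> D \<le> \<psi> r / 4\<close>. Adding 1 keeps the denominator
    positive.\<close>
  define \<epsilon> where "\<epsilon> = min (1 / 2) (\<psi> r / (8 * (\<psi> D + 1)))"
  have "\<epsilon> \<le> 1 / 2" by (simp only: \<epsilon>_def min.cobounded1)
  moreover have "0 < \<epsilon>" using \<psi>r \<psi>D by (simp add: \<epsilon>_def)
  ultimately have \<epsilon>: "0 < \<epsilon>" "\<epsilon> \<le> 1" "\<epsilon> \<le> 1 / 2" by simp_all
  have "2 * \<epsilon> * \<psi> D \<le> 2 * \<epsilon> * (\<psi> D + 1)" using \<epsilon> by simp
  also have "\<dots> \<le> 2 * (\<psi> r / (8 * (\<psi> D + 1))) * (\<psi> D + 1)"
    using \<psi>D by (intro mult_right_mono) (auto simp: \<epsilon>_def)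
  also have "\<dots> = \<psi> r / 4" using \<psi>D by (simp add: field_simps)
  also have "\<dots> < \<psi> r / 2" using \<psi>r by simp
  finally have \<epsilon>D: "2 * \<epsilon> * \<psi> D < \<psi> r / 2" .
  define Q where "Q = comb a b m \<epsilon>"
  obtain \<gamma> F where \<gamma>: "\<gamma> \<in> transport_maps P Q"
    and PQ: "emeasure lborel P = ennreal (2 / (1 + \<epsilon>\<^sup>2)) * emeasure lborel Q"
    and F: "F \<in> sets borel" "emeasure lborel F \<le> ennreal (2 * \<epsilon>) * emeasure lborel P"
    and AE: "AE p in lborel. p \<in> P \<longrightarrow> \<gamma> p \<in> P \<and> (p \<in> F \<or> dist p (\<gamma> p) \<le> 1 / m)"
    unfolding P_def Q_def by (rule comb_transport[OF ab \<epsilon>(1,2) m])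
  let ?v = "measure lborel P"
  have v: "emeasure lborel P = ennreal ?v" "0 < ?v" unfolding P_def by (rule emeasure_box_One)+
  have P_fm: "P \<in> fmeasurable lborel" unfolding P_def by (intro fmeasurableI) (auto simp: emeasure_lborel_box_eq)
  have F_le: "emeasure lborel F \<le> ennreal (2 * \<epsilon> * ?v)"
    using F(2) \<epsilon> by (simp add: v(1) ennreal_mult')
  then have F_fm: "F \<in> fmeasurable lborel"
    using F(1) by (intro fmeasurableI) (auto intro: le_less_trans)
  have mF: "measure lborel F \<le> 2 * \<epsilon> * ?v"
    unfolding measure_def[of _ F] using F_le v(2) \<epsilon>(1) by (intro enn2real_leI) auto
  have "(LINT x:P|lborel. \<psi> (dist x (\<gamma> x)))
      \<le> (\<integral>p. \<psi> (1 / m) * indicator P p + \<psi> D * indicator F p \<partial>lborel)"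
    unfolding set_lebesgue_integral_def
  \<comment> \<open>The rule asks for integrability of the dominating function only. As that
    function is nonnegative, the bound covers the default value 0 of the left integral.\<close>
  proof (rule integral_mono_AE')
    show "integrable lborel (\<lambda>p. \<psi> (1 / m) * indicator P p + \<psi> D * indicator F p)"
      using P_fm F_fm by (auto simp: fmeasurable_def)
    show "AE p in lborel. indicator P p *\<^sub>R \<psi> (dist p (\<gamma> p)) \<le> \<psi> (1 / m) * indicator P p + \<psi> D * indicator F p"
      using AE
    proof eventually_elim
      case (elim p)
      have "\<psi> (dist p (\<gamma> p)) \<le> \<psi> D" if "p \<in> P" using elim that dist_D mono by simp
      moreover have "\<psi> (dist p (\<gamma> p)) \<le> \<psi> (1 / m)" if "p \<in> P" "p \<notin> F" using elim that mono by simp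
      ultimately show ?case using \<psi>D nonneg[of "1 / m"] by (auto simp: indicator_def)
    qed
    show "AE p in lborel. 0 \<le> \<psi> (1 / m) * indicator P p + \<psi> D * indicator F p"
      using \<psi>D nonneg[of "1 / m"] by simp
  qed
  also have "\<dots> = \<psi> (1 / m) * ?v + \<psi> D * measure lborel F"
    using P_fm F_fm by (subst Bochner_Integration.integral_add) (auto simp: fmeasurable_def)
  also have "\<dots> \<le> \<psi> (1 / m) * ?v + \<psi> D * (2 * \<epsilon> * ?v)"
    using mF \<psi>D by (intro add_left_mono mult_left_mono)
  also have "\<dots> = (\<psi> (1 / m) + 2 * \<epsilon> * \<psi> D) * ?v" by (simp add: algebra_simps)
  also have "\<dots> < \<psi> r * ?v"
    using \<psi>m \<epsilon>D v(2) by (intro mult_strict_right_mono) auto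
  finally have "1 / ?v * (LINT x:P|lborel. \<psi> (dist x (\<gamma> x))) < \<psi> r"
    using v(2) by (simp add: field_simps)
  then have W: "wasserstein_dist \<psi> P Q < r"
    using wasserstein_dist_less[OF \<psi> \<gamma>] r by simp
  have Q: "Q \<in> star_regions" unfolding Q_def by (rule comb_star_region[OF ab \<epsilon>(1)])
  have QP: "Q \<subseteq> P" by (auto simp: Q_def P_def comb_def)
  have Q_fm: "Q \<in> fmeasurable lborel"
    using QP P_fm open_comb[of a b m \<epsilon>] by (intro fmeasurableI2[OF P_fm]) (auto simp: Q_def)
  have "?v = 2 / (1 + \<epsilon>\<^sup>2) * measure lborel Q"
    unfolding measure_def PQ using one_plus_square_pos[of \<epsilon>] by (simp add: enn2real_mult)
  then have "measure lborel Q = (1 + \<epsilon>\<^sup>2) / 2 * ?v"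
    using one_plus_square_pos[of \<epsilon>] by (simp add: field_simps)
  also have "\<dots> < 3 / 4 * ?v"
  proof (rule mult_strict_right_mono)
    have "\<epsilon>\<^sup>2 \<le> (1 / 2)\<^sup>2" using \<epsilon> by (intro power_mono) auto
    then show "(1 + \<epsilon>\<^sup>2) / 2 < 3 / 4" by (simp add: power2_eq_square)
  qed (rule v(2))
  finally have "?v / 4 < ?v - measure lborel Q" by simp
  also have "\<dots> = measure lborel (P - Q)"
    using measurable_measure_Diff[OF P_fm fmeasurableD[OF Q_fm] QP] by simp
  also have "P - Q = (P - Q) \<union> (Q - P)" using QP by blast
  finally have "?v / 4 < symdiff_dist P Q" by (simp add: symdiff_dist_def)
  with W Q show ?thesis by blast
qed

theorem theorem18:
  assumes "DIM('a::euclidean_space) \<ge> 2"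
  shows "\<not> (\<exists>\<psi>. mulholland \<psi> \<and>
            finer_topology
              (metric_topology (star_regions :: 'a set set) (wasserstein_dist \<psi>))
              (metric_topology (star_regions :: 'a set set) symdiff_dist))"
proof
  let ?S = "star_regions :: 'a set set"
  assume "\<exists>\<psi>. mulholland \<psi> \<and>
    finer_topology (metric_topology ?S (wasserstein_dist \<psi>)) (metric_topology ?S symdiff_dist)"
  then obtain \<psi> where \<psi>: "mulholland \<psi>"
    and finer: "finer_topology (metric_topology ?S (wasserstein_dist \<psi>)) (metric_topology ?S symdiff_dist)"
    by blast
  interpret Metric_space ?S symdiff_dist by (rule Metric_space_symdiff_dist)
  \<comment> \<open>The dimension hypothesis supplies two distinct axes.\<close>
  obtain a b :: 'a where ab: "a \<in> Basis" "b \<in> Basis" "a \<noteq> b"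
    using assms card_le_Suc0_iff_eq[of "Basis :: 'a set"] by auto
  define P :: "'a set" where "P = box (- One) One"
  define e where "e = measure lborel P / 4"
  have e: "0 < e" using emeasure_box_One(2)[where 'a = 'a] by (simp add: e_def P_def)
  have P: "P \<in> ?S" unfolding P_def by (rule box_One_star_region)
  \<comment> \<open>This ball about the cube would contain a Wasserstein ball about it, but the
    latter contains a comb at symmetric-difference distance more than \<open>e\<close>.\<close>
  have "openin (metric_topology ?S symdiff_dist) (mball P e)"
    using openin_mball metric_topology_eq_mtopology[OF Metric_space_symdiff_dist] by metis
  then have "openin (metric_topology ?S (wasserstein_dist \<psi>)) (mball P e)"
    using finer unfolding finer_topology_def by blast
  then obtain r where r: "0 < r" "{Q \<in> ?S. wasserstein_dist \<psi> P Q < r} \<subseteq> mball P e"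
    using P e unfolding openin_metric_topology by (meson centre_in_mball_iff)
  obtain Q where "Q \<in> ?S" "wasserstein_dist \<psi> P Q < r" "e < symdiff_dist P Q"
    using comb_close[OF ab \<psi> r(1)] unfolding P_def e_def by blast
  with r(2) show False by (auto simp: in_mball)
qed

end
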